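(* Let $\mu,\nu\in\mathcal P_1(\mathbb R)$. Then there exists a unique $\leq_c$-smallest measure $\nu^*$ among the measures $\eta\in\mathcal P_1(\mathbb R)$ with $\mu\leq_c\eta$ which can be pushed onto $\nu$ by an increasing 1-Lipschitz mapping. Moreover: (1) If $\theta\colon\mathbb R\to\mathbb R$ is convex, then $\nu^*$ is an optimizer of the problem $$\inf_{\eta:\ \mu\leq_c\eta}W_\theta(\eta,\nu).$$ If $\theta\colon\mathbb R\to\mathbb R$ is strictly convex and $V_\theta(\mu,\nu)$ is finite, then $\nu^*$ is the unique optimizer of this problem. (2) There exists a ($\nu^*$-a.s. unique) increasing 1-Lipschitz mapping $\tilde T$ which pushes $\nu^*$ onto $\nu$; $\tilde T$ has slope $1$ on each interval $I$ which is irreducible with respect to $(\mu,\nu^* )$. (3) $\tilde T$ is the weak monotone rearrangement between $\mu$ and $\nu$.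
   Context: $\mathcal P_1(\mathbb R)$ is the set of Borel probability measures on $\mathbb R$ with finite first moment; $S(\mu)$ is the push-forward of $\mu$ under $S$; "increasing" means nondecreasing; $\eta\leq_c\nu$ (convex order) means $\int\phi\,d\eta\leq\int\phi\,d\nu$ for all convex $\phi\colon\mathbb R\to\mathbb R$. $\Pi(\mu,\eta)$ is the set of couplings of $\mu$ and $\eta$; $W_\theta(\mu,\eta):=\inf_{\pi\in\Pi(\mu,\eta)}\int\theta(x-y)\,\pi(dx,dy)$, and $V_\theta(\mu,\nu):=\inf_{\mu^*\leq_c\nu}W_\theta(\mu,\mu^* )$. (It is known that $V_\theta(\mu,\nu)$ also equals $\inf_{\eta:\ \mu\leq_c\eta}W_\theta(\eta,\nu)$.) A function $S\colon\mathbb R\to\mathbb R$ is admissible (with respect to $\mu,\nu$) if it is increasing, 1-Lipschitz, and $S(\mu)\leq_c\nu$. The weak monotone rearrangement between $\mu$ and $\nu$ is the ($\mu$-a.s. unique, existing) admissible map $T$ such that $S(\mu)\leq_c T(\mu)$ for every admissible $S$. Irreducible intervals: put $u_\eta(y):=\int_{\mathbb R}|x-y|\,\eta(dx)$. If $\mu\leq_c\eta$ then $u_\mu\leq u_\eta$ and the open set $\{u_\mu<u_\eta\}$ is a union of at most countably many disjoint open intervals (its connected components); these are the intervals irreducible with respect to $(\mu,\eta)$. *)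

theory Defs
  imports "HOL-Probability.Probability"
begin

definition P1 :: "real measure set" where
  "P1 = {\<mu>. prob_space \<mu> \<and> sets \<mu> = sets borel \<and> integrable \<mu> (\<lambda>x. x)}"

(* Integral with values in [-\<infinity>, \<infinity>], as positive part minus negative part; ennreal truncates
   negative reals to 0.  In all uses below the integrand is convex in a variable with finite first
   moment, hence bounded below by an integrable affine function, so the subtrahend is finite and
   the case \<infinity> - \<infinity> does not arise.  (The Bochner integral would return 0 for non-integrable
   functions.) *)
definition ext_integral :: "'a measure \<Rightarrow> ('a \<Rightarrow> real) \<Rightarrow> ereal" where
  "ext_integral M f =
     enn2ereal (\<integral>\<^sup>+ x. ennreal (f x) \<partial>M) - enn2ereal (\<integral>\<^sup>+ x. ennreal (- f x) \<partial>M)"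

definition convex_le :: "real measure \<Rightarrow> real measure \<Rightarrow> bool" (infix "\<le>\<^sub>c" 50) where
  "\<eta> \<le>\<^sub>c \<nu> \<longleftrightarrow> (\<forall>\<phi>::real \<Rightarrow> real. convex_on UNIV \<phi> \<longrightarrow> ext_integral \<eta> \<phi> \<le> ext_integral \<nu> \<phi>)"

definition strictly_convex :: "(real \<Rightarrow> real) \<Rightarrow> bool" where
  "strictly_convex \<theta> \<longleftrightarrow>
     (\<forall>x y t. x \<noteq> y \<and> 0 < t \<and> t < 1 \<longrightarrow>
        \<theta> ((1 - t) * x + t * y) < (1 - t) * \<theta> x + t * \<theta> y)"

definition couplings :: "real measure \<Rightarrow> real measure \<Rightarrow> (real \<times> real) measure set" where
  "couplings \<mu> \<eta> =
     {\<pi>. prob_space \<pi> \<and> sets \<pi> = sets borel \<and> distr \<pi> borel fst = \<mu> \<and> distr \<pi> borel snd = \<eta>}"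

definition W :: "(real \<Rightarrow> real) \<Rightarrow> real measure \<Rightarrow> real measure \<Rightarrow> ereal" where
  "W \<theta> \<mu> \<eta> = (INF \<pi>\<in>couplings \<mu> \<eta>. ext_integral \<pi> (\<lambda>(x, y). \<theta> (x - y)))"

definition V :: "(real \<Rightarrow> real) \<Rightarrow> real measure \<Rightarrow> real measure \<Rightarrow> ereal" where
  "V \<theta> \<mu> \<nu> = (INF \<eta>\<in>{\<eta>\<in>P1. \<eta> \<le>\<^sub>c \<nu>}. W \<theta> \<mu> \<eta>)"

definition increasing_1_Lipschitz :: "(real \<Rightarrow> real) \<Rightarrow> bool" where
  "increasing_1_Lipschitz S \<longleftrightarrow> mono S \<and> 1-lipschitz_on UNIV S"

definition admissible :: "real measure \<Rightarrow> real measure \<Rightarrow> (real \<Rightarrow> real) \<Rightarrow> bool" where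
  "admissible \<mu> \<nu> S \<longleftrightarrow> increasing_1_Lipschitz S \<and> distr \<mu> borel S \<le>\<^sub>c \<nu>"

definition maximal_admissible :: "real measure \<Rightarrow> real measure \<Rightarrow> (real \<Rightarrow> real) \<Rightarrow> bool" where
  "maximal_admissible \<mu> \<nu> T \<longleftrightarrow>
     admissible \<mu> \<nu> T \<and> (\<forall>S. admissible \<mu> \<nu> S \<longrightarrow> distr \<mu> borel S \<le>\<^sub>c distr \<mu> borel T)"

(* "T is the weak monotone rearrangement": the second conjunct expresses that the defining property
   determines T up to \<mu>-null sets, as the definite article requires. *)
definition is_weak_monotone_rearrangement ::
    "real measure \<Rightarrow> real measure \<Rightarrow> (real \<Rightarrow> real) \<Rightarrow> bool" where
  "is_weak_monotone_rearrangement \<mu> \<nu> T \<longleftrightarrow>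
     maximal_admissible \<mu> \<nu> T \<and> (\<forall>S. maximal_admissible \<mu> \<nu> S \<longrightarrow> (AE x in \<mu>. S x = T x))"

definition potential :: "real measure \<Rightarrow> real \<Rightarrow> real" where
  "potential \<eta> y = (\<integral>x. \<bar>x - y\<bar> \<partial>\<eta>)"

definition irreducible_intervals :: "real measure \<Rightarrow> real measure \<Rightarrow> real set set" where
  "irreducible_intervals \<mu> \<eta> = components {y. potential \<mu> y < potential \<eta> y}"

definition dominating :: "real measure \<Rightarrow> real measure set" where
  "dominating \<mu> = {\<eta>\<in>P1. \<mu> \<le>\<^sub>c \<eta>}"

definition pushes_onto :: "(real \<Rightarrow> real) \<Rightarrow> real measure \<Rightarrow> real measure \<Rightarrow> bool" where
  "pushes_onto S \<eta> \<nu> \<longleftrightarrow> distr \<eta> borel S = \<nu>"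

definition is_smallest :: "real measure set \<Rightarrow> real measure \<Rightarrow> bool" where
  "is_smallest A \<eta> \<longleftrightarrow> \<eta> \<in> A \<and> (\<forall>\<eta>'\<in>A. \<eta> \<le>\<^sub>c \<eta>')"

definition is_optimizer ::
    "(real \<Rightarrow> real) \<Rightarrow> real measure \<Rightarrow> real measure \<Rightarrow> real measure \<Rightarrow> bool" where
  "is_optimizer \<theta> \<mu> \<nu> \<eta> \<longleftrightarrow>
     \<eta> \<in> dominating \<mu> \<and> W \<theta> \<eta> \<nu> = (INF \<eta>'\<in>dominating \<mu>. W \<theta> \<eta>' \<nu>)"

end

theory Submission
  imports Defs
begin

text \<open>
  Let \<open>q\<close>, \<open>r\<close> be the quantile functions of \<open>\<mu>\<close>, \<open>\<nu>\<close> on the unit interval. For \<open>\<eta>\<close> with quantile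
  function \<open>e\<close>, the relation \<open>\<mu> \<le>\<^sub>c \<eta>\<close> says that the primitive of \<open>e\<close> lies below that of \<open>q\<close>, with equality
  at the right endpoint, and \<open>\<eta>\<close> is pushed onto \<open>\<nu>\<close> by an increasing 1-Lipschitz map iff \<open>e - r\<close> is
  increasing. So the smallest \<open>\<eta>\<close> is the law of \<open>r + g\<close>, where \<open>g\<close> is the derivative of the largest convex
  minorant of the primitive \<open>D\<close> of \<open>q - r\<close>.

  Every level set of \<open>g\<close> ends at a contact point of \<open>D\<close> and its minorant; hence the law of \<open>g\<close> is \<open>\<le>\<^sub>c\<close> the
  law of any \<open>h\<close> whose primitive lies below \<open>D\<close>. Since the comonotone coupling is optimal, this gives the
  optimality statements for all convex costs at once; strict convexity and the midpoint of two optimal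
  gaps give uniqueness. Let \<open>T\<close> push \<open>\<nu>\<^sup>*\<close> onto \<open>\<nu>\<close>. At a contact point, the potentials of \<open>\<mu>\<close> and \<open>\<nu>\<^sup>*\<close> agree
  at the corresponding level of \<open>x - T x\<close>; this yields slope 1 on irreducible intervals and
  \<open>q - T \<circ> q = g\<close> almost everywhere, from which the maximality of \<open>T\<close> follows.
\<close>

section \<open>Convex order from a rearrangement criterion\<close>

text \<open>The integrable minorant \<open>l\<close> keeps the negative part finite, so
  non-integrability can only come from the positive part, and the value is then \<infinity>.\<close>

lemma ext_integral_bounded_below:
  assumes f: "f \<in> borel_measurable M" and l: "integrable M l" and le: "\<And>x. x \<in> space M \<Longrightarrow> l x \<le> f x"
  shows "ext_integral M f = (if integrable M f then ereal (integral\<^sup>L M f) else \<infinity>)"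
proof -
  have "(\<integral>\<^sup>+ x. ennreal (- f x) \<partial>M) \<le> (\<integral>\<^sup>+ x. ennreal (norm (l x)) \<partial>M)"
    by (intro nn_integral_mono ennreal_leI) (use le in force)
  also have "\<dots> < \<infinity>" using l by (simp add: integrable_iff_bounded)
  finally have neg: "(\<integral>\<^sup>+ x. ennreal (- f x) \<partial>M) < \<infinity>" .
  then obtain b where b: "b \<ge> 0" "(\<integral>\<^sup>+ x. ennreal (- f x) \<partial>M) = ennreal b"
    by (cases "\<integral>\<^sup>+ x. ennreal (- f x) \<partial>M") auto
  show ?thesis
  proof (cases "integrable M f")
    case True
    then have "(\<integral>\<^sup>+ x. ennreal (f x) \<partial>M) \<noteq> \<infinity>" by (simp add: real_integrable_def)
    then obtain a where a: "a \<ge> 0" "(\<integral>\<^sup>+ x. ennreal (f x) \<partial>M) = ennreal a"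
      by (cases "\<integral>\<^sup>+ x. ennreal (f x) \<partial>M") auto
    show ?thesis using True a b
      by (simp add: ext_integral_def real_lebesgue_integral_def enn2ereal_ennreal)
  next
    case False
    then have "(\<integral>\<^sup>+ x. ennreal (f x) \<partial>M) = \<infinity>" using neg f by (auto simp: real_integrable_def)
    then show ?thesis using False b by (simp add: ext_integral_def enn2ereal_ennreal)
  qed
qed

lemma ext_integral_distr:
  assumes "f \<in> borel_measurable N" "X \<in> M \<rightarrow>\<^sub>M N"
  shows "ext_integral (distr M N X) f = ext_integral M (\<lambda>x. f (X x))"
  using assms by (simp add: ext_integral_def nn_integral_distr)

lemma convex_borel_measurable:
  fixes \<phi> :: "real \<Rightarrow> real"
  assumes "convex_on UNIV \<phi>"
  shows "\<phi> \<in> borel_measurable borel"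
  using convex_on_continuous[OF _ assms] by (intro borel_measurable_continuous_onI) auto

text \<open>The infimum of the right difference quotients is the right derivative, a subgradient at
  every point. Adding the subgradient inequalities at two points gives its monotonicity.\<close>

lemma convex_subgradient:
  fixes \<phi> :: "real \<Rightarrow> real"
  assumes "convex_on UNIV \<phi>"
  obtains \<psi> where "mono \<psi>" "\<And>x y. \<phi> x + \<psi> x * (y - x) \<le> \<phi> y"
proof -
  define \<psi> where "\<psi> x = Inf ((\<lambda>t. (\<phi> x - \<phi> t) / (x - t)) ` {x<..})" for x
  have sub: "\<phi> x + \<psi> x * (y - x) \<le> \<phi> y" for x y
    using convex_le_Inf_differential[OF assms, of x y] by (simp add: \<psi>_def)
  have "\<psi> x \<le> \<psi> y" if "x \<le> y" for x y
  proof (cases "x = y")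
    case False
    have "0 \<le> (\<psi> y - \<psi> x) * (y - x)"
      using sub[of x y] sub[of y x] by (simp add: algebra_simps)
    then show ?thesis using False that by (simp add: zero_le_mult_iff)
  qed simp
  then show thesis using sub that by (blast intro: monoI)
qed

section \<open>Integration over superlevel sets of monotone functions\<close>

lemma up_closed_cases:
  fixes S :: "real set"
  assumes up: "\<And>x y. x \<in> S \<Longrightarrow> x \<le> y \<Longrightarrow> y \<in> S"
  shows "S = {} \<or> S = UNIV \<or> (\<exists>k. S = {k<..}) \<or> (\<exists>k. S = {k..})"
proof (cases "S = {} \<or> \<not> bdd_below S")
  case True
  have "S = UNIV" if "\<not> bdd_below S"
    using that up unfolding bdd_below_def by (metis UNIV_eq_I linear)
  then show ?thesis using True by metis
next
  case False
  then have ne: "S \<noteq> {}" and bdd: "bdd_below S" by auto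
  have 1: "x \<in> S" if "Inf S < x" for x
    using cInf_lessD[OF ne that] up by (meson less_imp_le)
  have 2: "Inf S \<le> x" if "x \<in> S" for x using cInf_lower[OF that bdd] .
  show ?thesis
  proof (cases "Inf S \<in> S")
    case True
    then have "S = {Inf S..}" using 1 2 by (auto simp: le_less)
    then show ?thesis by blast
  next
    case False
    then have "S = {Inf S<..}" using 1 2 by (auto simp: less_le)
    then show ?thesis by blast
  qed
qed

context prob_space
begin

text \<open>The closed half-line from \<open>k\<close> is the decreasing limit of the open ones from
  \<open>k - 1 / Suc n\<close>; dominated convergence with bound \<open>norm (Z \<omega>)\<close>
  carries the inequality over.\<close>

lemma expectation_up_closed_nonneg:
  fixes X Z :: "'a \<Rightarrow> real"
  assumes X[measurable]: "X \<in> borel_measurable M" and Z: "integrable M Z"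
    and tot: "0 \<le> expectation Z"
    and pos: "\<And>k. 0 \<le> expectation (\<lambda>\<omega>. indicator {k<..} (X \<omega>) * Z \<omega>)"
    and up: "\<And>x y. x \<in> S \<Longrightarrow> x \<le> y \<Longrightarrow> y \<in> S"
  shows "0 \<le> expectation (\<lambda>\<omega>. indicator S (X \<omega>) * Z \<omega>)"
proof -
  consider "S = {}" | "S = UNIV" | k where "S = {k<..}" | k where "S = {k..}"
    using up_closed_cases[of S] up by metis
  then show ?thesis
  proof cases
    case (4 k)
    have [measurable]: "Z \<in> borel_measurable M" using Z by auto
    have "(\<lambda>n. expectation (\<lambda>\<omega>. indicator {k - 1 / Suc n<..} (X \<omega>) * Z \<omega>))
        \<longlonglongrightarrow> expectation (\<lambda>\<omega>. indicator S (X \<omega>) * Z \<omega>)"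
    proof (rule integral_dominated_convergence)
      show "integrable M (\<lambda>\<omega>. norm (Z \<omega>))" using Z by auto
      show "AE \<omega> in M. (\<lambda>n. indicator {k - 1 / Suc n<..} (X \<omega>) * Z \<omega>) \<longlonglongrightarrow> indicator S (X \<omega>) * Z \<omega>"
      proof (intro AE_I2 tendsto_mult tendsto_const)
        fix \<omega>
        show "(\<lambda>n. indicator {k - 1 / Suc n<..} (X \<omega>) :: real) \<longlonglongrightarrow> indicator S (X \<omega>)"
        proof (cases "k \<le> X \<omega>")
          case True
          then have "k - 1 / Suc n < X \<omega>" for n :: nat
            by (smt (verit) divide_pos_pos of_nat_0_less_iff zero_less_Suc)
          then show ?thesis using True by (simp add: 4)
        next
          case False
          have "(\<lambda>n. k - 1 / Suc n) \<longlonglongrightarrow> k - 0" by (intro tendsto_intros LIMSEQ_Suc[OF lim_1_over_n])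
          then have "\<forall>\<^sub>F n in sequentially. X \<omega> < k - 1 / Suc n"
            using False by (intro order_tendstoD) auto
          then have "\<forall>\<^sub>F n in sequentially. indicator {k - 1 / Suc n<..} (X \<omega>) = (indicator S (X \<omega>) :: real)"
            by eventually_elim (use False in \<open>auto simp: 4 split: split_indicator\<close>)
          then show ?thesis by (rule tendsto_eventually)
        qed
      qed
      show "AE \<omega> in M. norm (indicator {k - 1 / Suc n<..} (X \<omega>) * Z \<omega>) \<le> norm (Z \<omega>)" for n
        by (auto split: split_indicator)
    qed (simp_all add: 4)
    then show ?thesis by (rule tendsto_lowerbound) (use pos in auto)
  qed (use tot pos in simp_all)
qed

text \<open>Layer-cake formula: \<open>\<psi> x + B\<close> is the length of the set of
  \<open>t\<close> in \<open>{- B..B}\<close> with \<open>t < \<psi> x\<close>. Fubini turns the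
  expectation of \<open>(\<psi> (X \<omega>) + B) * Z \<omega>\<close> into an integral over
  \<open>t\<close> of expectations on superlevel sets, each nonnegative. The constant
  \<open>B\<close> drops out because \<open>Z\<close> has mean 0.\<close>

lemma expectation_mono_times_nonneg:
  fixes X Z :: "'a \<Rightarrow> real"
  assumes X[measurable]: "X \<in> borel_measurable M" and Z: "integrable M Z"
    and tot: "expectation Z = 0"
    and pos: "\<And>k. 0 \<le> expectation (\<lambda>\<omega>. indicator {k<..} (X \<omega>) * Z \<omega>)"
    and \<psi>: "mono (\<psi> :: real \<Rightarrow> real)" and bd: "\<And>x. \<bar>\<psi> x\<bar> \<le> B"
  shows "0 \<le> expectation (\<lambda>\<omega>. \<psi> (X \<omega>) * Z \<omega>)"
proof -
  interpret P: pair_sigma_finite M lborel by standard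
  have [measurable]: "Z \<in> borel_measurable M" using Z by auto
  have [measurable]: "\<psi> \<in> borel_measurable borel" using \<psi> by (rule borel_measurable_mono)
  have mX[measurable]: "(\<lambda>\<omega>. \<psi> (X \<omega>)) \<in> borel_measurable M" by measurable
  define f where "f = (\<lambda>\<omega> t. indicator {- B..B} t * (if t < \<psi> (X \<omega>) then Z \<omega> else 0))"
  have [measurable]: "case_prod f \<in> borel_measurable (M \<Otimes>\<^sub>M lborel)"
    unfolding f_def by measurable
  have ind: "integrable lborel (indicator {- B..B} :: real \<Rightarrow> real)"
    by (rule integrable_real_indicator) (auto simp: emeasure_lborel_Icc_eq)
  have intg: "integrable (M \<Otimes>\<^sub>M lborel) (case_prod f)"
  proof (rule Bochner_Integration.integrable_bound)
    show "integrable (M \<Otimes>\<^sub>M lborel) (\<lambda>(\<omega>, t). Z \<omega> * indicator {- B..B} t)"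
      using Z ind by (intro P.Fubini_integrable) (auto simp: abs_mult)
    show "AE x in M \<Otimes>\<^sub>M lborel. norm (case_prod f x) \<le> norm (case x of (\<omega>, t) \<Rightarrow> Z \<omega> * indicator {- B..B} t)"
      by (auto simp: f_def split: split_indicator)
  qed simp
  have 1: "(LINT t|lborel. f \<omega> t) = (\<psi> (X \<omega>) + B) * Z \<omega>" for \<omega>
  proof -
    have B: "- B \<le> \<psi> (X \<omega>)" "\<psi> (X \<omega>) \<le> B" using bd[of "X \<omega>"] by auto
    have "f \<omega> = (\<lambda>t. Z \<omega> * indicator {- B..<\<psi> (X \<omega>)} t)"
      using B by (auto simp: f_def fun_eq_iff split: split_indicator)
    then show ?thesis using B by simp
  qed
  have 2: "0 \<le> (LINT \<omega>|M. f \<omega> t)" for t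
  proof -
    have "f \<omega> t = indicator {- B..B} t * (indicator {x. t < \<psi> x} (X \<omega>) * Z \<omega>)" for \<omega>
      by (auto simp: f_def split: split_indicator)
    moreover have "0 \<le> expectation (\<lambda>\<omega>. indicator {x. t < \<psi> x} (X \<omega>) * Z \<omega>)"
      by (rule expectation_up_closed_nonneg[OF X Z _ pos]) (use tot \<psi> in \<open>auto dest: monoD intro: less_le_trans\<close>)
    ultimately show ?thesis by (simp)
  qed
  have "0 \<le> (LINT t|lborel. (LINT \<omega>|M. f \<omega> t))" by (intro integral_nonneg_AE) (use 2 in auto)
  also have "\<dots> = (LINT \<omega>|M. (LINT t|lborel. f \<omega> t))"
    using P.Fubini_integral[OF intg] by simp
  also have "\<dots> = expectation (\<lambda>\<omega>. \<psi> (X \<omega>) * Z \<omega> + B * Z \<omega>)"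
    unfolding 1 by (simp add: algebra_simps)
  also have "\<dots> = expectation (\<lambda>\<omega>. \<psi> (X \<omega>) * Z \<omega>)"
  proof -
    have "integrable M (\<lambda>\<omega>. \<psi> (X \<omega>) * Z \<omega>)"
    proof (rule Bochner_Integration.integrable_bound)
      show "integrable M (\<lambda>\<omega>. B * Z \<omega>)" using Z by auto
      have "\<bar>\<psi> x\<bar> \<le> \<bar>B\<bar>" for x using bd[of x] by auto
      then show "AE \<omega> in M. norm (\<psi> (X \<omega>) * Z \<omega>) \<le> norm (B * Z \<omega>)"
        by (auto simp: abs_mult intro!: mult_right_mono)
    qed measurable
    then show ?thesis using Z tot by simp
  qed
  finally show ?thesis .
qed

end

lemma ext_integral_convex:
  fixes \<phi> X :: "_ \<Rightarrow> real"
  assumes "finite_measure M" "integrable M X" "convex_on UNIV \<phi>"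
  shows "ext_integral M (\<lambda>\<omega>. \<phi> (X \<omega>)) =
    (if integrable M (\<lambda>\<omega>. \<phi> (X \<omega>)) then ereal (\<integral>\<omega>. \<phi> (X \<omega>) \<partial>M) else \<infinity>)"
proof -
  interpret finite_measure M by fact
  obtain \<psi> where \<psi>: "\<And>x y. \<phi> x + \<psi> x * (y - x) \<le> \<phi> y"
    using convex_subgradient[OF assms(3)] by blast
  have [measurable]: "X \<in> borel_measurable M" "\<phi> \<in> borel_measurable borel"
    using assms convex_borel_measurable by auto
  show ?thesis
  proof (rule ext_integral_bounded_below)
    show "integrable M (\<lambda>\<omega>. \<phi> 0 + \<psi> 0 * X \<omega>)" using assms(2) by simp
    show "\<phi> 0 + \<psi> 0 * X \<omega> \<le> \<phi> (X \<omega>)" for \<omega> using \<psi>[of 0 "X \<omega>"] by simp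
  qed simp
qed

text \<open>The subgradient of \<open>\<phi>\<close> is clamped to a bounded monotone function, which yields convex
  functions increasing to \<open>\<phi>\<close>.\<close>

proposition (in prob_space) convex_leI:
  fixes X Y :: "'a \<Rightarrow> real"
  assumes X: "integrable M X" and Y: "integrable M Y"
    and tot: "expectation X = expectation Y"
    and pos: "\<And>k. 0 \<le> expectation (\<lambda>\<omega>. indicator {k<..} (X \<omega>) * (Y \<omega> - X \<omega>))"
  shows "distr M borel X \<le>\<^sub>c distr M borel Y"
  unfolding convex_le_def
proof (intro allI impI)
  fix \<phi> :: "real \<Rightarrow> real" assume \<phi>: "convex_on UNIV \<phi>"
  obtain \<psi> where mono: "mono \<psi>" and sub: "\<And>x y. \<phi> x + \<psi> x * (y - x) \<le> \<phi> y"
    using convex_subgradient[OF \<phi>] by blast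
  have [measurable]: "X \<in> borel_measurable M" "Y \<in> borel_measurable M" "\<phi> \<in> borel_measurable borel"
    "\<psi> \<in> borel_measurable borel"
    using X Y convex_borel_measurable[OF \<phi>] borel_measurable_mono[OF mono] by auto
  define c where "c n x = max (- real n) (min (real n) x)" for n x
  have c[measurable]: "c n \<in> borel_measurable borel" for n unfolding c_def by measurable
  \<comment> \<open>\<open>\<phi>' n\<close> agrees with \<open>\<phi>\<close> on
    \<open>{- real n..real n}\<close> and is continued outside by lines of slope
    \<open>\<psi> (- real n)\<close> and \<open>\<psi> (real n)\<close>.\<close>
  define \<phi>' where "\<phi>' n x = \<phi> (c n x) + \<psi> (c n x) * (x - c n x)" for n x
  have tangent: "\<phi>' n x + \<psi> (c n x) * (y - x) \<le> \<phi>' n y" for n x y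
  proof -
    \<comment> \<open>Where \<open>y\<close> lies above its clamp, \<open>c n y\<close> is the
      largest clamped value, and where it lies below, the smallest. So the slopes compare in the
      direction that the sign of \<open>y - c n y\<close> requires.\<close>
    have "\<psi> (c n x) * (y - c n y) \<le> \<psi> (c n y) * (y - c n y)"
    proof (cases "y - c n y" "0::real" rule: linorder_cases)
      case less
      then have "c n y \<le> c n x" by (auto simp: c_def)
      then show ?thesis using less mono by (simp add: mult_right_mono_neg monoD)
    next
      case greater
      then have "c n x \<le> c n y" by (auto simp: c_def)
      then show ?thesis using greater mono by (simp add: mult_right_mono monoD)
    qed simp
    then show ?thesis using sub[of "c n x" "c n y"] by (simp add: \<phi>'_def algebra_simps)
  qed
  have mono': "mono (\<lambda>x. \<psi> (c n x))" for n
    using mono by (auto simp: c_def intro!: monoI intro: monoD)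
  have bd: "\<bar>\<psi> (c n x)\<bar> \<le> \<bar>\<psi> (- real n)\<bar> + \<bar>\<psi> (real n)\<bar>" for n x
    using monoD[OF mono, of "- real n" "c n x"] monoD[OF mono, of "c n x" "real n"] unfolding c_def by linarith
  have le: "\<phi>' n x \<le> \<phi> x" for n x unfolding \<phi>'_def by (rule sub)
  have lim: "(\<lambda>n. \<phi>' n x) \<longlonglongrightarrow> \<phi> x" for x
  proof (rule tendsto_eventually)
    obtain N :: nat where "\<bar>x\<bar> \<le> real N" using real_arch_simple by blast
    then have "c n x = x" if "n \<ge> N" for n using that by (auto simp: c_def)
    then show "\<forall>\<^sub>F n in sequentially. \<phi>' n x = \<phi> x"
      unfolding \<phi>'_def eventually_sequentially by (intro exI[of _ N]) auto
  qed
  have lower: "\<phi> 0 + \<psi> 0 * x \<le> \<phi>' n x" for n x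
    using tangent[of n 0 x] by (simp add: \<phi>'_def c_def)
  have int': "integrable M (\<lambda>\<omega>. \<phi>' n (V \<omega>))" if V: "integrable M V" for n V
  proof -
    have [measurable]: "V \<in> borel_measurable M" using V by auto
    define K where "K = \<bar>\<psi> (- real n)\<bar> + \<bar>\<psi> (real n)\<bar>"
    have up: "\<phi>' n x \<le> \<phi> 0 + K * \<bar>x\<bar>" for x
    proof -
      have "\<phi>' n x \<le> \<phi> 0 + \<psi> (c n x) * x" using tangent[of n x 0] by (simp add: \<phi>'_def c_def)
      also have "\<psi> (c n x) * x \<le> \<bar>\<psi> (c n x)\<bar> * \<bar>x\<bar>" by (metis abs_ge_self abs_mult)
      also have "\<dots> \<le> K * \<bar>x\<bar>" using bd unfolding K_def by (intro mult_right_mono) auto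
      finally show ?thesis by simp
    qed
    show ?thesis
    proof (rule Bochner_Integration.integrable_bound)
      show "integrable M (\<lambda>\<omega>. \<bar>\<phi> 0 + K * \<bar>V \<omega>\<bar>\<bar> + \<bar>\<phi> 0 + \<psi> 0 * V \<omega>\<bar>)" using V by auto
      show "AE \<omega> in M. norm (\<phi>' n (V \<omega>)) \<le> norm (\<bar>\<phi> 0 + K * \<bar>V \<omega>\<bar>\<bar> + \<bar>\<phi> 0 + \<psi> 0 * V \<omega>\<bar>)"
        using lower up by (intro AE_I2) (smt (verit) real_norm_def)
    qed (simp add: \<phi>'_def)
  qed
  have step: "expectation (\<lambda>\<omega>. \<phi>' n (X \<omega>)) \<le> expectation (\<lambda>\<omega>. \<phi>' n (Y \<omega>))" for n
  proof -
    have int\<psi>: "integrable M (\<lambda>\<omega>. \<psi> (c n (X \<omega>)) * (Y \<omega> - X \<omega>))"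
    proof (rule Bochner_Integration.integrable_bound)
      show "integrable M (\<lambda>\<omega>. (\<bar>\<psi> (- real n)\<bar> + \<bar>\<psi> (real n)\<bar>) * (Y \<omega> - X \<omega>))" using X Y by auto
      show "AE \<omega> in M. norm (\<psi> (c n (X \<omega>)) * (Y \<omega> - X \<omega>))
          \<le> norm ((\<bar>\<psi> (- real n)\<bar> + \<bar>\<psi> (real n)\<bar>) * (Y \<omega> - X \<omega>))"
        using bd by (auto simp: abs_mult intro!: mult_right_mono)
    qed measurable
    \<comment> \<open>The tangent of \<open>\<phi>' n\<close> at \<open>X\<close> has bounded
      monotone slope, so its first-order contribution is nonnegative by the hypothesis on superlevel
      sets of \<open>X\<close>.\<close>
    have "0 \<le> expectation (\<lambda>\<omega>. \<psi> (c n (X \<omega>)) * (Y \<omega> - X \<omega>))"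
      by (rule expectation_mono_times_nonneg[OF _ _ _ pos mono' bd]) (use X Y tot in auto)
    then have "expectation (\<lambda>\<omega>. \<phi>' n (X \<omega>)) \<le>
        expectation (\<lambda>\<omega>. \<phi>' n (X \<omega>) + \<psi> (c n (X \<omega>)) * (Y \<omega> - X \<omega>))"
      using int\<psi> int'[OF X] by simp
    also have "\<dots> \<le> expectation (\<lambda>\<omega>. \<phi>' n (Y \<omega>))"
      using int\<psi> int' X Y tangent by (intro integral_mono) auto
    finally show ?thesis .
  qed
  show "ext_integral (distr M borel X) \<phi> \<le> ext_integral (distr M borel Y) \<phi>"
  proof (cases "integrable M (\<lambda>\<omega>. \<phi> (Y \<omega>))")
    case True
    define e where "e = expectation (\<lambda>\<omega>. \<phi> (Y \<omega>))"
    \<comment> \<open>Subtracting an affine minorant makes the integrands nonnegative. Fatou's lemma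
      then passes the bound to \<open>\<phi>\<close> and yields the integrability of
      \<open>\<phi> (X \<omega>)\<close> at the same time.\<close>
    define l where "l = (\<lambda>\<omega>. \<phi> 0 + \<psi> 0 * X \<omega>)"
    have l: "integrable M l" using X by (simp add: l_def)
    have bnd: "expectation (\<lambda>\<omega>. \<phi>' n (X \<omega>) - l \<omega>) \<le> e - expectation l" for n
    proof -
      have "expectation (\<lambda>\<omega>. \<phi>' n (Y \<omega>)) \<le> e"
        unfolding e_def using le int'[OF Y] True by (intro integral_mono) auto
      then show ?thesis using step[of n] int'[OF X] l by simp
    qed
    have "(\<integral>\<^sup>+ \<omega>. ennreal (\<phi> (X \<omega>) - l \<omega>) \<partial>M) = (\<integral>\<^sup>+ \<omega>. liminf (\<lambda>n. ennreal (\<phi>' n (X \<omega>) - l \<omega>)) \<partial>M)"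
      by (intro nn_integral_cong lim_imp_Liminf[symmetric] tendsto_ennrealI tendsto_intros lim) auto
    also have "\<dots> \<le> liminf (\<lambda>n. \<integral>\<^sup>+ \<omega>. ennreal (\<phi>' n (X \<omega>) - l \<omega>) \<partial>M)"
      by (rule nn_integral_liminf) (simp add: \<phi>'_def l_def)
    also have "\<dots> \<le> ennreal (e - expectation l)"
    proof (rule Liminf_le)
      have "(\<integral>\<^sup>+ \<omega>. ennreal (\<phi>' n (X \<omega>) - l \<omega>) \<partial>M) = ennreal (expectation (\<lambda>\<omega>. \<phi>' n (X \<omega>) - l \<omega>))" for n
        using int'[OF X] l lower by (intro nn_integral_eq_integral) (auto simp: l_def)
      then show "\<forall>\<^sub>F n in sequentially. (\<integral>\<^sup>+ \<omega>. ennreal (\<phi>' n (X \<omega>) - l \<omega>) \<partial>M) \<le> ennreal (e - expectation l)"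
        using bnd by (simp add: ennreal_leI)
    qed simp
    finally have fin: "(\<integral>\<^sup>+ \<omega>. ennreal (\<phi> (X \<omega>) - l \<omega>) \<partial>M) \<le> ennreal (e - expectation l)" .
    have nn: "0 \<le> \<phi> (X \<omega>) - l \<omega>" for \<omega> using sub[of 0 "X \<omega>"] by (simp add: l_def)
    have int_diff: "integrable M (\<lambda>\<omega>. \<phi> (X \<omega>) - l \<omega>)"
      by (rule integrableI_nonneg[OF _ AE_I2[OF nn] le_less_trans[OF fin]]) (simp_all add: l_def)
    then have intX: "integrable M (\<lambda>\<omega>. \<phi> (X \<omega>))"
      using Bochner_Integration.integrable_add[OF int_diff l] by simp
    \<comment> \<open>\<open>ennreal\<close> truncates negative numbers to 0, so the bound
      \<open>e - expectation l\<close> must be known to be nonnegative before it can be read in the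
      reals.\<close>
    have "0 \<le> expectation (\<lambda>\<omega>. \<phi>' 0 (X \<omega>) - l \<omega>)"
      using lower by (intro integral_nonneg_AE) (auto simp: l_def)
    then have "0 \<le> e - expectation l" using bnd[of 0] by linarith
    then have "expectation (\<lambda>\<omega>. \<phi> (X \<omega>) - l \<omega>) \<le> e - expectation l"
      using fin nn_integral_eq_integral[OF int_diff] nn by (simp add: ennreal_le_iff)
    then have "expectation (\<lambda>\<omega>. \<phi> (X \<omega>)) \<le> e" using intX l by simp
    then show ?thesis
      using intX True ext_integral_convex[OF finite_measure_axioms _ \<phi>] X Y
      by (simp add: ext_integral_distr e_def)
  next
    case False
    then show ?thesis
      using ext_integral_convex[OF finite_measure_axioms Y \<phi>] by (simp add: ext_integral_distr)
  qed
qed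

section \<open>Functions on the unit interval and quantiles\<close>

lemma convex_hinge: "convex_on UNIV (\<lambda>x::real. max 0 (k - x))"
proof (rule convex_onI)
  fix t x y :: real assume t: "0 < t" "t < 1"
  then have "(1 - t) * (k - x) \<le> (1 - t) * max 0 (k - x)" "t * (k - y) \<le> t * max 0 (k - y)"
    by (auto intro!: mult_left_mono)
  moreover have "0 \<le> (1 - t) * max 0 (k - x)" "0 \<le> t * max 0 (k - y)" using t by auto
  moreover have "k - ((1 - t) *\<^sub>R x + t *\<^sub>R y) = (1 - t) * (k - x) + t * (k - y)"
    by (simp add: algebra_simps)
  ultimately show "max 0 (k - ((1 - t) *\<^sub>R x + t *\<^sub>R y)) \<le> (1 - t) * max 0 (k - x) + t * max 0 (k - y)"
    by (simp only: max.bounded_iff) linarith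
qed auto

lemma P1_D:
  assumes "\<eta> \<in> P1"
  shows "prob_space \<eta>" "sets \<eta> = sets borel" "integrable \<eta> (\<lambda>x. x)" "real_distribution \<eta>"
  using assms by (auto simp: P1_def real_distribution_def real_distribution_axioms_def)

lemma integrable_hinge:
  fixes f :: "'a \<Rightarrow> real"
  assumes "finite_measure M" "integrable M f"
  shows "integrable M (\<lambda>x. max 0 (k - f x))"
proof -
  interpret finite_measure M by fact
  show ?thesis using assms(2) by (intro integrable_max) auto
qed

lemma convex_leD:
  assumes le: "\<eta> \<le>\<^sub>c \<nu>" and P: "\<eta> \<in> P1" "\<nu> \<in> P1" and \<phi>: "convex_on UNIV \<phi>"
    and int: "integrable \<eta> \<phi>" "integrable \<nu> \<phi>"
  shows "integral\<^sup>L \<eta> \<phi> \<le> integral\<^sup>L \<nu> \<phi>"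
proof -
  have "ext_integral \<rho> \<phi> = ereal (integral\<^sup>L \<rho> \<phi>)" if "\<rho> \<in> P1" "integrable \<rho> \<phi>" for \<rho>
    using ext_integral_convex[of \<rho> "\<lambda>x. x" \<phi>] that \<phi> P1_D[OF that(1)]
    by (simp add: prob_space.axioms(1) prob_space.finite_measure)
  then show ?thesis using le \<phi> int P unfolding convex_le_def by fastforce
qed

lemma
  assumes le: "\<eta> \<le>\<^sub>c \<nu>" and P: "\<eta> \<in> P1" "\<nu> \<in> P1"
  shows convex_le_mean: "(\<integral>x. x \<partial>\<eta>) = (\<integral>x. x \<partial>\<nu>)"
    and convex_le_hinge: "(\<integral>x. max 0 (k - x) \<partial>\<eta>) \<le> (\<integral>x. max 0 (k - x) \<partial>\<nu>)"
proof -
  have "(\<integral>x. x \<partial>\<eta>) \<le> (\<integral>x. x \<partial>\<nu>)"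
    by (rule convex_leD[OF assms]) (use P1_D P in \<open>auto simp: convex_on_def\<close>)
  moreover have "(\<integral>x. - x \<partial>\<eta>) \<le> (\<integral>x. - x \<partial>\<nu>)"
    by (rule convex_leD[OF assms]) (use P1_D P in \<open>auto simp: convex_on_def\<close>)
  ultimately show "(\<integral>x. x \<partial>\<eta>) = (\<integral>x. x \<partial>\<nu>)" by simp
  show "(\<integral>x. max 0 (k - x) \<partial>\<eta>) \<le> (\<integral>x. max 0 (k - x) \<partial>\<nu>)"
    by (rule convex_leD[OF assms convex_hinge])
       (use P1_D P in \<open>auto intro!: integrable_hinge simp: prob_space.finite_measure\<close>)
qed

section \<open>Lebesgue measure on the unit interval and primitives\<close>

text \<open>The endpoints are left out so that quantile functions of laws with unbounded support are
  real valued throughout.\<close>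

definition unif :: "real measure" where
  "unif = restrict_space lborel {0<..<1}"

lemma space_unif [simp]: "space unif = {0<..<1}"
  by (simp add: unif_def space_restrict_space)

interpretation unif: prob_space unif
  unfolding unif_def by (auto simp: emeasure_restrict_space space_restrict_space intro!: prob_spaceI)

lemma AE_unif_iff: "(AE u in unif. P u) \<longleftrightarrow> (AE u in lborel. 0 < u \<and> u < 1 \<longrightarrow> P u)"
  unfolding unif_def by (subst AE_restrict_space_iff) auto

lemma AE_unif_countable: "countable A \<Longrightarrow> AE u in unif. u \<notin> A"
  unfolding AE_unif_iff
  using AE_not_in[OF countable_imp_null_set_lborel] by fastforce

lemma borel_measurable_unif: "f \<in> borel_measurable borel \<Longrightarrow> f \<in> borel_measurable unif"
  unfolding unif_def by (rule measurable_restrict_space1) auto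

lemma measurable_unif_indicator [measurable]:
  "A \<in> sets borel \<Longrightarrow> indicator A \<in> borel_measurable unif"
  by (rule borel_measurable_unif) simp

lemma mono_on_measurable_unif: "mono_on {0<..<1} f \<Longrightarrow> f \<in> borel_measurable unif"
  for f :: "real \<Rightarrow> real"
  using borel_measurable_mono_on_fnc[of "{0<..<1}" f]
  by (simp add: unif_def cong: measurable_cong_sets)

text \<open>The primitive of \<open>f\<close> on the unit interval. The indicator extends it to the
  whole line, by 0 on the left and by the total integral on the right.\<close>

definition lower :: "(real \<Rightarrow> real) \<Rightarrow> real \<Rightarrow> real" where
  "lower f a = (\<integral>u. indicator {..a} u * f u \<partial>unif)"

lemma integrable_unif_indicator [simp, intro]:
  fixes f :: "real \<Rightarrow> real"
  assumes "integrable unif f" "A \<in> sets borel"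
  shows "integrable unif (\<lambda>u. indicator A u * f u)"
proof -
  have [measurable]: "f \<in> borel_measurable unif" "indicator A \<in> borel_measurable unif"
    using assms by auto
  show ?thesis
    by (rule Bochner_Integration.integrable_bound[OF assms(1)]) (auto split: split_indicator)
qed

lemma lower_add: "integrable unif f \<Longrightarrow> integrable unif g \<Longrightarrow> lower (\<lambda>u. f u + g u) a = lower f a + lower g a"
  by (simp add: lower_def distrib_left)

lemma lower_diff: "integrable unif f \<Longrightarrow> integrable unif g \<Longrightarrow> lower (\<lambda>u. f u - g u) a = lower f a - lower g a"
  by (simp add: lower_def right_diff_distrib)

lemma lower_cmult: "lower (\<lambda>u. c * f u) a = c * lower f a"
  by (simp add: lower_def mult.left_commute)

lemma lower_cong_AE:
  assumes "AE u in unif. f u = g u" "f \<in> borel_measurable unif" "g \<in> borel_measurable unif"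
  shows "lower f a = lower g a"
  unfolding lower_def using assms by (intro integral_cong_AE) auto

lemma measure_unif_atMost: "0 \<le> a \<Longrightarrow> a \<le> 1 \<Longrightarrow> measure unif ({0<..<1} \<inter> {..a}) = a"
proof -
  assume a: "0 \<le> a" "a \<le> 1"
  have "measure unif ({0<..<1} \<inter> {..a}) = measure lborel ({0<..<1} \<inter> {..a})"
    unfolding unif_def by (rule measure_restrict_space) auto
  also have "\<dots> = measure lborel {0<..<a}"
    unfolding measure_def
  proof (intro arg_cong[where f=enn2real] emeasure_eq_AE)
    show "AE x in lborel. (x \<in> {0<..<1} \<inter> {..a}) = (x \<in> {0<..<a})"
      using AE_lborel_singleton[of a] by eventually_elim (use a in auto)
  qed auto
  finally show ?thesis using a by simp
qed

lemma lower_const: "0 \<le> a \<Longrightarrow> a \<le> 1 \<Longrightarrow> lower (\<lambda>u. k) a = k * a"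
proof -
  assume a: "0 \<le> a" "a \<le> 1"
  have "(\<integral>u. indicator {..a} u \<partial>unif) = measure unif ({..a} \<inter> space unif)"
    by (rule Bochner_Integration.integral_indicator)
  also have "\<dots> = a" using measure_unif_atMost[OF a] by (simp add: Int_commute)
  finally show ?thesis by (simp add: lower_def)
qed

lemma lower_eq_0: "a \<le> 0 \<Longrightarrow> lower f a = 0"
  unfolding lower_def by (intro integral_eq_zero_AE AE_I2) (auto simp: indicator_def)

lemma lower_eq_integral: "1 \<le> a \<Longrightarrow> lower f a = (\<integral>u. f u \<partial>unif)"
  unfolding lower_def by (intro Bochner_Integration.integral_cong refl) (auto simp: indicator_def)

lemma integral_greaterThan_eq:
  assumes "integrable unif f"
  shows "(\<integral>u. indicator {a<..} u * f u \<partial>unif) = (\<integral>u. f u \<partial>unif) - lower f a"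
proof -
  have "(\<integral>u. indicator {a<..} u * f u \<partial>unif) = (\<integral>u. f u - indicator {..a} u * f u \<partial>unif)"
    by (intro Bochner_Integration.integral_cong refl) (auto split: split_indicator)
  then show ?thesis using assms by (simp add: lower_def)
qed

lemma integral_Ioc_eq:
  assumes "integrable unif f" "u \<le> v"
  shows "(\<integral>w. indicator {u<..v} w * f w \<partial>unif) = lower f v - lower f u"
proof -
  have "(\<integral>w. indicator {u<..v} w * f w \<partial>unif)
      = (\<integral>w. indicator {..v} w * f w - indicator {..u} w * f w \<partial>unif)"
    using assms by (intro Bochner_Integration.integral_cong refl) (auto split: split_indicator)
  then show ?thesis using assms by (simp add: lower_def)
qed

lemma integral_Ioc_const:
  assumes "0 \<le> u" "u \<le> v" "v \<le> 1"
  shows "(\<integral>w. indicator {u<..v} w * k \<partial>unif) = k * (v - u)"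
  using integral_Ioc_eq[of "\<lambda>_. k" u v] lower_const assms by (simp add: algebra_simps)

text \<open>Dominated convergence: the indicators of \<open>{..s n}\<close> converge to that of
  \<open>{..x}\<close> off the null set \<open>{x}\<close>.\<close>

lemma continuous_on_lower:
  assumes "integrable unif f"
  shows "continuous_on UNIV (lower f)"
proof -
  have [measurable]: "f \<in> borel_measurable unif" using assms by auto
  have "(\<lambda>n. lower f (s n)) \<longlonglongrightarrow> lower f x" if s: "s \<longlonglongrightarrow> x" for s x
    unfolding lower_def
  proof (rule integral_dominated_convergence)
    show "integrable unif (\<lambda>u. norm (f u))" using assms by auto
    have "AE u in unif. u \<notin> {x}" by (rule AE_unif_countable) auto
    then show "AE u in unif. (\<lambda>n. indicator {..s n} u * f u) \<longlonglongrightarrow> indicator {..x} u * f u"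
    proof eventually_elim
      fix u assume "u \<notin> {x}"
      have "\<forall>\<^sub>F n in sequentially. u < s n" if "u < x"
        using order_tendstoD(1)[OF s that] .
      moreover have "\<forall>\<^sub>F n in sequentially. s n < u" if "x < u"
        using order_tendstoD(2)[OF s that] .
      ultimately have "\<forall>\<^sub>F n in sequentially. indicator {..s n} u = (indicator {..x} u :: real)"
        using \<open>u \<notin> {x}\<close>
        by (cases "u < x") (auto split: split_indicator elim!: eventually_mono)
      then show "(\<lambda>n. indicator {..s n} u * f u) \<longlonglongrightarrow> indicator {..x} u * f u"
        by (intro tendsto_mult tendsto_const tendsto_eventually)
    qed
    show "AE u in unif. norm (indicator {..s n} u * f u) \<le> norm (f u)" for n
      by (auto split: split_indicator)
  qed measurable
  then show ?thesis by (auto simp: continuous_on_sequentially comp_def)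
qed

section \<open>Conjugacy of primitives and hinge integrals\<close>

text \<open>The gap in Young's inequality between \<open>lower f\<close> and the hinge integral,
  which are convex conjugates of each other when \<open>f\<close> is increasing. It is nonnegative
  because \<open>max 0 t\<close> dominates both \<open>t\<close> and 0.\<close>

lemma lower_hinge_gap:
  assumes f: "integrable unif f" and a: "0 \<le> a" "a \<le> 1"
  shows "integrable unif (\<lambda>u. max 0 (k - f u) - indicator {..a} u * (k - f u))"
    and "(\<integral>u. max 0 (k - f u) - indicator {..a} u * (k - f u) \<partial>unif)
      = (\<integral>u. max 0 (k - f u) \<partial>unif) + lower f a - k * a"
    and "0 \<le> max 0 (k - f u) - indicator {..a} u * (k - f u)"
proof -
  have 1: "integrable unif (\<lambda>u. max 0 (k - f u))"
    using f by (intro integrable_hinge) (rule unif.finite_measure_axioms)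
  have 2: "integrable unif (\<lambda>u. indicator {..a} u * (k - f u))" using f by auto
  show "integrable unif (\<lambda>u. max 0 (k - f u) - indicator {..a} u * (k - f u))" using 1 2 by auto
  have "(\<integral>u. indicator {..a} u * (k - f u) \<partial>unif) = k * a - lower f a"
    using lower_diff[of "\<lambda>_. k" f a] f lower_const[OF a, of k] by (simp add: lower_def)
  then show "(\<integral>u. max 0 (k - f u) - indicator {..a} u * (k - f u) \<partial>unif)
      = (\<integral>u. max 0 (k - f u) \<partial>unif) + lower f a - k * a"
    using 1 2 by simp
  show "0 \<le> max 0 (k - f u) - indicator {..a} u * (k - f u)" by (auto split: split_indicator)
qed

lemma lower_hinge_le:
  assumes "integrable unif f" "0 \<le> a" "a \<le> 1"
  shows "k * a - (\<integral>u. max 0 (k - f u) \<partial>unif) \<le> lower f a"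
proof -
  have "0 \<le> (\<integral>u. max 0 (k - f u) - indicator {..a} u * (k - f u) \<partial>unif)"
    by (intro integral_nonneg_AE AE_I2 lower_hinge_gap(3)[OF assms])
  then show ?thesis using lower_hinge_gap(2)[OF assms, of k] by simp
qed

text \<open>A nonnegative gap with integral 0 vanishes almost everywhere. Equality in Young's
  inequality thus locates the point where \<open>f\<close> crosses the level \<open>k\<close>; this
  is how contact points become pointwise statements.\<close>

lemma lower_hinge_eq_iff:
  assumes "integrable unif f" "0 \<le> a" "a \<le> 1"
  shows "lower f a = k * a - (\<integral>u. max 0 (k - f u) \<partial>unif) \<longleftrightarrow>
    (AE u in unif. (u \<le> a \<longrightarrow> f u \<le> k) \<and> (a < u \<longrightarrow> k \<le> f u))"
proof -
  have "(AE u in unif. max 0 (k - f u) - indicator {..a} u * (k - f u) = 0) \<longleftrightarrow>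
      (AE u in unif. (u \<le> a \<longrightarrow> f u \<le> k) \<and> (a < u \<longrightarrow> k \<le> f u))"
    by (intro AE_cong) (auto split: split_indicator)
  then show ?thesis
    using integral_nonneg_eq_0_iff_AE[OF lower_hinge_gap(1)[OF assms, of k] AE_I2[OF lower_hinge_gap(3)[OF assms]]]
      lower_hinge_gap(2)[OF assms, of k] by auto
qed

text \<open>An increasing \<open>f\<close> crosses the level \<open>f a\<close> at \<open>a\<close>:
  the value \<open>f a\<close> is the slope of a line supporting the primitive there.\<close>

lemma lower_hinge_mono:
  assumes "integrable unif f" "mono_on {0<..<1} f" "0 < a" "a < 1"
  shows "lower f a = f a * a - (\<integral>u. max 0 (f a - f u) \<partial>unif)"
  using assms by (subst lower_hinge_eq_iff) (auto intro!: AE_I2 intro: mono_onD[OF assms(2)])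

section \<open>Quantile functions, their levels and uniqueness\<close>

text \<open>No one-sided continuity is demanded, so a sum of two such functions is again a quantile
  function of its own law. Uniqueness then holds almost everywhere.\<close>

definition quantile_of :: "real measure \<Rightarrow> (real \<Rightarrow> real) \<Rightarrow> bool" where
  "quantile_of \<eta> e \<longleftrightarrow> mono_on {0<..<1} e \<and> integrable unif e \<and> distr unif borel e = \<eta>"

lemma distr_unif_P1:
  assumes "integrable unif f"
  shows "distr unif borel f \<in> P1"
  using assms by (auto simp: P1_def integrable_distr_eq intro!: unif.prob_space_distr)

lemma quantile_of_exists:
  assumes "\<eta> \<in> P1"
  obtains e where "quantile_of \<eta> e"
proof -
  interpret cdf_distribution \<eta> using P1_D(4)[OF assms] by (simp add: cdf_distribution_def)
  have d: "distr unif borel I = \<eta>" unfolding unif_def by (rule distr_I_eq_M)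
  have m: "mono_on {0<..<1} I" using mono_I .
  have "integrable (distr unif borel I) (\<lambda>x. x)" unfolding d using P1_D(3)[OF assms] .
  then have "integrable unif I" using mono_on_measurable_unif[OF m] by (simp add: integrable_distr_eq)
  then show thesis using that[of I] d m by (auto simp: quantile_of_def)
qed

text \<open>The point where an increasing \<open>e\<close> passes the level \<open>k\<close>.
  Inserting 0 keeps the set nonempty, so the value is 0 when \<open>e\<close> exceeds
  \<open>k\<close> everywhere.\<close>

definition level :: "(real \<Rightarrow> real) \<Rightarrow> real \<Rightarrow> real" where
  "level e k = Sup (insert 0 {u\<in>{0<..<1}. e u \<le> k})"

lemma level:
  assumes "mono_on {0<..<1} e"
  shows "0 \<le> level e k" "level e k \<le> 1"
    and "\<And>u. 0 < u \<Longrightarrow> u < level e k \<Longrightarrow> e u \<le> k"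
    and "\<And>u. u < 1 \<Longrightarrow> level e k < u \<Longrightarrow> k < e u"
proof -
  let ?S = "insert 0 {u\<in>{0<..<1}. e u \<le> k}"
  have bdd: "bdd_above ?S" by (rule bdd_aboveI[of _ 1]) auto
  show 0: "0 \<le> level e k" unfolding level_def using bdd by (intro cSup_upper) auto
  show "level e k \<le> 1" unfolding level_def by (intro cSup_least) auto
  show "e u \<le> k" if u: "0 < u" "u < level e k" for u
  proof -
    obtain v where "v \<in> ?S" "u < v" using less_cSupD[of ?S u] u(2) unfolding level_def by auto
    then have "v \<in> {0<..<1}" "e v \<le> k" "u < v" using that by auto
    then show ?thesis using mono_onD[OF assms, of u v] that by auto
  qed
  show "k < e u" if "u < 1" "level e k < u" for u
  proof (rule ccontr)
    assume "\<not> k < e u"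
    then have "u \<in> ?S" using that 0 by auto
    then have "u \<le> level e k" unfolding level_def using bdd by (intro cSup_upper)
    then show False using that by simp
  qed
qed

lemma level_unique:
  assumes "mono_on {0<..<1} e" "u \<in> {0<..<1}"
    and "\<And>v. 0 < v \<Longrightarrow> v < u \<Longrightarrow> e v \<le> k" "\<And>v. u < v \<Longrightarrow> v < 1 \<Longrightarrow> k < e v"
  shows "level e k = u"
proof (rule ccontr)
  assume "level e k \<noteq> u"
  then consider "level e k < u" | "u < level e k" by linarith
  then show False
  proof cases
    case 1
    then obtain v where v: "level e k < v" "v < u" using dense by blast
    then have "0 < v" "v < 1" using level(1)[OF assms(1), where k=k] assms(2) by auto
    then show False using v level(4)[OF assms(1), where k=k and u=v] assms(3)[of v] by simp
  next
    case 2
    then obtain v where v: "u < v" "v < level e k" using dense by blast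
    then have "0 < v" "v < 1" using level(2)[OF assms(1), where k=k] assms(2) by auto
    then show False using v level(3)[OF assms(1), where k=k and u=v] assms(4)[of v] by simp
  qed
qed

text \<open>If \<open>e u\<close> and \<open>f u\<close> differ, a rational \<open>k\<close> lies
  strictly between them, and the interlacing forces \<open>e\<close> to pass \<open>k\<close>
  exactly at \<open>u\<close>. So the exceptional points are levels of rationals, a countable
  set.\<close>

lemma interlaced_AE_eq:
  fixes e f :: "real \<Rightarrow> real"
  assumes e: "mono_on {0<..<1} e"
    and ef: "\<And>u v. 0 < u \<Longrightarrow> u < v \<Longrightarrow> v < 1 \<Longrightarrow> e u \<le> f v"
    and fe: "\<And>u v. 0 < u \<Longrightarrow> u < v \<Longrightarrow> v < 1 \<Longrightarrow> f u \<le> e v"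
  shows "AE u in unif. e u = f u"
proof -
  have "AE u in unif. u \<notin> level e ` \<rat>" by (intro AE_unif_countable countable_image countable_rat)
  then show ?thesis
  proof (rule AE_mp, intro AE_I2 impI)
    fix u assume u: "u \<in> space unif" "u \<notin> level e ` \<rat>"
    show "e u = f u"
    proof (rule ccontr)
      assume "e u \<noteq> f u"
      then have "min (e u) (f u) < max (e u) (f u)" by auto
      then obtain k where k: "k \<in> \<rat>" "min (e u) (f u) < k" "k < max (e u) (f u)"
        using Rats_dense_in_real by blast
      have "level e k = u"
      proof (rule level_unique[OF e])
        show "e v \<le> k" if "0 < v" "v < u" for v
          using ef[of v u] mono_onD[OF e, of v u] that u k by (auto simp: min_def split: if_splits)
        show "k < e v" if "u < v" "v < 1" for v
          using fe[of u v] mono_onD[OF e, of u v] that u k by (auto simp: max_def split: if_splits)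
      qed (use u in auto)
      then show False using u k by auto
    qed
  qed
qed

text \<open>If \<open>h v < g u\<close> with \<open>u < v\<close>, then \<open>h\<close> stays below
  \<open>h v\<close> on all of \<open>{0<..v}\<close>, while \<open>g\<close> does so at most on
  \<open>{0<..u}\<close>; the two distribution functions would differ at \<open>h v\<close>. Hence
  the functions interlace.\<close>

lemma mono_on_distr_unique:
  fixes e f :: "real \<Rightarrow> real"
  assumes e: "mono_on {0<..<1} e" and f: "mono_on {0<..<1} f"
    and eq: "distr unif borel e = distr unif borel f"
  shows "AE u in unif. e u = f u"
proof -
  have *: "g u \<le> h v" if g: "mono_on {0<..<1} g" and h: "mono_on {0<..<1} h"
    and eq: "distr unif borel g = distr unif borel h" and uv: "0 < u" "u < v" "v < 1" for g h :: "real \<Rightarrow> real" and u v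
  proof (rule ccontr)
    assume "\<not> g u \<le> h v"
    note [measurable] = mono_on_measurable_unif[OF g] mono_on_measurable_unif[OF h]
    have "v = measure unif ({0<..<1} \<inter> {..v})" using measure_unif_atMost uv by simp
    also have "\<dots> \<le> measure unif (h -` {..h v} \<inter> space unif)"
    proof (rule unif.finite_measure_mono)
      show "h -` {..h v} \<inter> space unif \<in> unif.events"
        using mono_on_measurable_unif[OF h] by (rule measurable_sets) simp
    qed (use uv mono_onD[OF h] in auto)
    also have "\<dots> = measure (distr unif borel h) {..h v}" by (subst measure_distr) auto
    also have "\<dots> = measure unif (g -` {..h v} \<inter> space unif)"
      unfolding eq[symmetric] by (subst measure_distr) auto
    also have "\<dots> \<le> measure unif ({0<..<1} \<inter> {..u})"
    proof (rule unif.finite_measure_mono)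
      show "{0<..<1} \<inter> {..u} \<in> unif.events"
        unfolding unif_def by (subst sets_restrict_space_iff) auto
      have "w \<le> u" if "0 < w" "w < 1" "g w \<le> h v" for w
        using mono_onD[OF g, of u w] that uv \<open>\<not> g u \<le> h v\<close> by (intro leI) auto
      then show "g -` {..h v} \<inter> space unif \<subseteq> {0<..<1} \<inter> {..u}" by auto
    qed
    also have "\<dots> = u" using measure_unif_atMost uv by simp
    finally show False using uv by simp
  qed
  show ?thesis by (rule interlaced_AE_eq[OF e *[OF e f eq] *[OF f e eq[symmetric]]])
qed

text \<open>Equal primitives give equal averages over \<open>{u<..v}\<close>. That average is at
  least \<open>g u\<close> and at most \<open>h v\<close>, so the functions interlace.\<close>

lemma mono_on_lower_unique:
  assumes e: "mono_on {0<..<1} e" "integrable unif e" and f: "mono_on {0<..<1} f" "integrable unif f"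
    and eq: "\<And>a. 0 < a \<Longrightarrow> a < 1 \<Longrightarrow> lower e a = lower f a"
  shows "AE u in unif. e u = f u"
proof -
  have len: "(\<integral>w. indicator {u<..v} w * k \<partial>unif) = k * (v - u)" if "0 < u" "u < v" "v < 1" for u v k
    using integral_Ioc_const[of u v k] that by linarith
  have *: "g u \<le> h v" if g: "mono_on {0<..<1} g" "integrable unif g" and h: "mono_on {0<..<1} h" "integrable unif h"
    and eq: "\<And>a. 0 < a \<Longrightarrow> a < 1 \<Longrightarrow> lower g a = lower h a" and uv: "0 < u" "u < v" "v < 1" for g h u v
  proof -
    have "g u * (v - u) = (\<integral>w. indicator {u<..v} w * g u \<partial>unif)" by (rule len[OF uv, symmetric])
    also have "\<dots> \<le> (\<integral>w. indicator {u<..v} w * g w \<partial>unif)"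
      using g uv by (intro integral_mono integrable_unif_indicator)
        (auto split: split_indicator intro!: mono_onD[OF g(1)])
    also have "\<dots> = (\<integral>w. indicator {u<..v} w * h w \<partial>unif)"
      using integral_Ioc_eq[OF g(2)] integral_Ioc_eq[OF h(2)] eq uv by simp
    also have "\<dots> \<le> (\<integral>w. indicator {u<..v} w * h v \<partial>unif)"
      using h uv by (intro integral_mono integrable_unif_indicator)
        (auto split: split_indicator intro!: mono_onD[OF h(1)])
    also have "\<dots> = h v * (v - u)" by (rule len[OF uv])
    finally show ?thesis using uv by simp
  qed
  show ?thesis by (rule interlaced_AE_eq[OF e(1) *[OF e f eq] *[OF f e eq[symmetric]]])
qed

section \<open>Convex order through primitives of quantile functions\<close>

text \<open>With \<open>k = f a\<close>, Young's inequality is an equality for \<open>f\<close> and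
  an inequality for \<open>e\<close>, so the order of the hinge integrals is reversed on the
  primitives.\<close>

lemma lower_le_of_hinge:
  assumes "integrable unif e" "integrable unif f" "mono_on {0<..<1} f"
    and "\<And>k. (\<integral>u. max 0 (k - e u) \<partial>unif) \<le> (\<integral>u. max 0 (k - f u) \<partial>unif)"
    and a: "0 < a" "a < 1"
  shows "lower f a \<le> lower e a"
  using lower_hinge_mono[OF assms(2,3) a] lower_hinge_le[OF assms(1), of a "f a"] assms(4)[of "f a"] a
  by simp

lemma convex_le_lowerD:
  assumes le: "distr unif borel e \<le>\<^sub>c distr unif borel f"
    and e: "integrable unif e" and f: "integrable unif f"
  shows "(\<integral>u. e u \<partial>unif) = (\<integral>u. f u \<partial>unif)"
    and "mono_on {0<..<1} f \<Longrightarrow> 0 \<le> a \<Longrightarrow> a \<le> 1 \<Longrightarrow> lower f a \<le> lower e a"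
proof -
  note P = distr_unif_P1[OF e] distr_unif_P1[OF f]
  have [measurable]: "e \<in> borel_measurable unif" "f \<in> borel_measurable unif" using e f by auto
  show tot: "(\<integral>u. e u \<partial>unif) = (\<integral>u. f u \<partial>unif)"
    using convex_le_mean[OF le P] by (simp add: integral_distr)
  have "(\<integral>u. max 0 (k - e u) \<partial>unif) \<le> (\<integral>u. max 0 (k - f u) \<partial>unif)" for k
    using convex_le_hinge[OF le P, of k] by (simp add: integral_distr)
  then show "lower f a \<le> lower e a" if "mono_on {0<..<1} f" "0 \<le> a" "a \<le> 1"
    using lower_le_of_hinge[OF e f that(1)] that tot
    by (cases "a = 0 \<or> a = 1") (auto simp: lower_eq_0 lower_eq_integral)
qed

text \<open>Up to a null set, the superlevel set of \<open>e\<close> at \<open>k\<close> is the part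
  of the interval right of \<open>level e k\<close>. The rearrangement criterion therefore compares
  the primitives at that one point.\<close>

lemma convex_le_lowerI:
  assumes m: "mono_on {0<..<1} e" and e: "integrable unif e" and h: "integrable unif h"
    and tot: "(\<integral>u. e u \<partial>unif) = (\<integral>u. h u \<partial>unif)"
    and le: "\<And>a. 0 < a \<Longrightarrow> a < 1 \<Longrightarrow> lower h a \<le> lower e a"
  shows "distr unif borel e \<le>\<^sub>c distr unif borel h"
proof (rule unif.convex_leI[OF e h tot])
  fix k
  define a where "a = level e k"
  note a = level[OF m, where k=k, folded a_def]
  have [measurable]: "e \<in> borel_measurable unif" "h \<in> borel_measurable unif" using e h by auto
  have "AE u in unif. u \<notin> {a}" by (rule AE_unif_countable) auto
  then have *: "AE u in unif. indicator {k<..} (e u) * (h u - e u) = indicator {a<..} u * (h u - e u)"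
  proof (rule AE_mp, intro AE_I2 impI)
    fix u assume u: "u \<in> space unif" "u \<notin> {a}"
    then show "indicator {k<..} (e u) * (h u - e u) = indicator {a<..} u * (h u - e u)"
      using a(3,4)[of u] by (auto split: split_indicator)
  qed
  have "(\<integral>u. indicator {k<..} (e u) * (h u - e u) \<partial>unif) = (\<integral>u. indicator {a<..} u * (h u - e u) \<partial>unif)"
    by (rule integral_cong_AE[OF _ _ *]) measurable
  also have "\<dots> = lower e a - lower h a"
    using e h tot by (subst integral_greaterThan_eq) (simp_all add: lower_diff)
  also have "\<dots> \<ge> 0"
    using le[of a] a(1,2) tot by (cases "a = 0 \<or> a = 1") (auto simp: lower_eq_0 lower_eq_integral)
  finally show "0 \<le> (\<integral>u. indicator {k<..} (e u) * (h u - e u) \<partial>unif)" .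
qed

lemma convex_le_antisym:
  assumes "\<eta> \<le>\<^sub>c \<nu>" "\<nu> \<le>\<^sub>c \<eta>" "\<eta> \<in> P1" "\<nu> \<in> P1"
  shows "\<eta> = \<nu>"
proof -
  obtain e f where e: "quantile_of \<eta> e" and f: "quantile_of \<nu> f"
    using quantile_of_exists assms(3,4) by metis
  have "AE u in unif. e u = f u"
  proof (rule mono_on_lower_unique)
    fix a :: real assume "0 < a" "a < 1"
    then show "lower e a = lower f a"
      using convex_le_lowerD(2)[of e f a] convex_le_lowerD(2)[of f e a] assms(1,2) e f
      by (auto simp: quantile_of_def)
  qed (use e f in \<open>auto simp: quantile_of_def\<close>)
  then have "distr unif borel e = distr unif borel f"
    using e f by (intro distr_cong_AE) (auto simp: quantile_of_def)
  then show ?thesis using e f by (simp add: quantile_of_def)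
qed

text \<open>By conjugacy the hinge integrals order the primitives of the quantile functions, and
  these decide the convex order. This reduces couplings to hinge costs, which can be computed from
  the marginals.\<close>

lemma convex_le_hingeI:
  assumes P: "\<eta> \<in> P1" "\<nu> \<in> P1"
    and tot: "(\<integral>x. x \<partial>\<eta>) = (\<integral>x. x \<partial>\<nu>)"
    and hinge: "\<And>k. (\<integral>x. max 0 (k - x) \<partial>\<eta>) \<le> (\<integral>x. max 0 (k - x) \<partial>\<nu>)"
  shows "\<eta> \<le>\<^sub>c \<nu>"
proof -
  obtain e f where e: "quantile_of \<eta> e" and f: "quantile_of \<nu> f"
    using quantile_of_exists P by metis
  note D = e[unfolded quantile_of_def] f[unfolded quantile_of_def]
  have [measurable]: "e \<in> borel_measurable unif" "f \<in> borel_measurable unif" using D by auto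
  have "(\<integral>u. e u \<partial>unif) = (\<integral>x. x \<partial>distr unif borel e)" "(\<integral>u. f u \<partial>unif) = (\<integral>x. x \<partial>distr unif borel f)"
    "(\<integral>u. max 0 (k - e u) \<partial>unif) = (\<integral>x. max 0 (k - x) \<partial>distr unif borel e)"
    "(\<integral>u. max 0 (k - f u) \<partial>unif) = (\<integral>x. max 0 (k - x) \<partial>distr unif borel f)" for k
    by (simp_all add: integral_distr)
  then have "distr unif borel e \<le>\<^sub>c distr unif borel f"
    using D tot hinge by (intro convex_le_lowerI lower_le_of_hinge) auto
  then show ?thesis using D by simp
qed

section \<open>The largest convex minorant\<close>

lemma abs_lower_le:
  assumes "integrable unif f"
  shows "\<bar>lower f a\<bar> \<le> (\<integral>u. \<bar>f u\<bar> \<partial>unif)"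
proof -
  have "\<bar>lower f a\<bar> \<le> (\<integral>u. \<bar>indicator {..a} u * f u\<bar> \<partial>unif)"
    unfolding lower_def by (rule integral_abs_bound)
  also have "\<dots> \<le> (\<integral>u. \<bar>f u\<bar> \<partial>unif)"
    using assms by (intro integral_mono) (auto split: split_indicator)
  finally show ?thesis .
qed

text \<open>Cut the interval into \<open>Suc N\<close> equal pieces: the increments of
  \<open>\<alpha>\<close> telescope and the mesh factor tends to 0. This identifies two functions
  with matching slopes without differentiating them.\<close>

lemma eq_of_product_modulus:
  fixes \<psi> \<alpha> :: "real \<Rightarrow> real"
  assumes "k \<le> l"
    and mod: "\<And>s t. k \<le> s \<Longrightarrow> s \<le> t \<Longrightarrow> t \<le> l \<Longrightarrow> \<bar>\<psi> t - \<psi> s\<bar> \<le> (t - s) * (\<alpha> t - \<alpha> s)"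
  shows "\<psi> l = \<psi> k"
proof -
  have bound: "\<bar>\<psi> l - \<psi> k\<bar> \<le> (l - k) * (\<alpha> l - \<alpha> k) / Suc N" for N
  proof -
    define h where "h = (l - k) / Suc N"
    have h: "0 \<le> h" "k + Suc N * h = l" using assms(1) by (auto simp: h_def)
    have "\<bar>\<psi> (k + real n * h) - \<psi> k\<bar> \<le> h * (\<alpha> (k + real n * h) - \<alpha> k)" if "n \<le> Suc N" for n
      using that
    proof (induction n)
      case (Suc n)
      have "real (Suc n) * h \<le> Suc N * h" using Suc.prems h by (intro mult_right_mono) auto
      then have "\<bar>\<psi> (k + real (Suc n) * h) - \<psi> (k + real n * h)\<bar>
          \<le> h * (\<alpha> (k + real (Suc n) * h) - \<alpha> (k + real n * h))"
        using mod[of "k + real n * h" "k + real (Suc n) * h"] h by (simp add: algebra_simps)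
      then show ?case using Suc by (simp add: right_diff_distrib)
    qed simp
    from this[of "Suc N"] show ?thesis using h(2) by (simp add: h_def)
  qed
  have "(\<lambda>N. (l - k) * (\<alpha> l - \<alpha> k) * (1 / Suc N)) \<longlonglongrightarrow> (l - k) * (\<alpha> l - \<alpha> k) * 0"
    by (intro tendsto_intros LIMSEQ_Suc[OF lim_1_over_n])
  then have "\<bar>\<psi> l - \<psi> k\<bar> \<le> 0"
    using bound by (intro LIMSEQ_le_const) auto
  then show ?thesis by simp
qed

text \<open>\<open>lower g\<close> is the largest convex minorant of \<open>lower d\<close> on the unit interval, and the points
  \<open>\<alpha> k\<close> are contact points of the two.\<close>

locale convex_minorant =
  fixes d g \<alpha> :: "real \<Rightarrow> real"
  assumes int_d: "integrable unif d" and int_g: "integrable unif g"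
    and mono_g: "mono_on {0<..<1} g"
    and \<alpha>: "0 \<le> \<alpha> k" "\<alpha> k \<le> 1"
    and g_le_iff: "0 < u \<Longrightarrow> u < 1 \<Longrightarrow> g u \<le> k \<longleftrightarrow> u \<le> \<alpha> k"
    and contact: "lower g (\<alpha> k) = lower d (\<alpha> k)"
    and lower_le: "0 \<le> a \<Longrightarrow> a \<le> 1 \<Longrightarrow> lower g a \<le> lower d a"
    and total: "(\<integral>u. g u \<partial>unif) = (\<integral>u. d u \<partial>unif)"
begin

text \<open>The superlevel set of \<open>g\<close> at \<open>k\<close> begins at the contact point
  \<open>\<alpha> k\<close>, where \<open>lower g\<close> may be replaced by \<open>lower d\<close>.
  The criterion then reads \<open>lower h (\<alpha> k) \<le> lower d (\<alpha> k)\<close>.\<close>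

lemma convex_le:
  assumes h: "integrable unif h" "(\<integral>u. h u \<partial>unif) = (\<integral>u. d u \<partial>unif)"
    and le: "\<And>a. 0 \<le> a \<Longrightarrow> a \<le> 1 \<Longrightarrow> lower h a \<le> lower d a"
  shows "distr unif borel g \<le>\<^sub>c distr unif borel h"
proof (rule unif.convex_leI[OF int_g h(1)])
  fix k
  have "(\<integral>u. indicator {k<..} (g u) * (h u - g u) \<partial>unif) = (\<integral>u. indicator {\<alpha> k<..} u * (h u - g u) \<partial>unif)"
    using g_le_iff[of _ k] by (intro Bochner_Integration.integral_cong refl) (auto split: split_indicator simp: not_le[symmetric])
  also have "\<dots> = lower d (\<alpha> k) - lower h (\<alpha> k)"
    using h int_g total contact by (subst integral_greaterThan_eq) (simp_all add: lower_diff)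
  also have "\<dots> \<ge> 0" using le \<alpha> by simp
  finally show "0 \<le> (\<integral>u. indicator {k<..} (g u) * (h u - g u) \<partial>unif)" .
qed (use h total in simp)

text \<open>For increasing \<open>h\<close> the convex order between the laws of \<open>g\<close>
  and \<open>h\<close> is itself the comparison of primitives.\<close>

lemma lower_maximal:
  assumes "mono_on {0<..<1} h" "integrable unif h" "(\<integral>u. h u \<partial>unif) = (\<integral>u. d u \<partial>unif)"
    and "\<And>a. 0 \<le> a \<Longrightarrow> a \<le> 1 \<Longrightarrow> lower h a \<le> lower d a"
    and "0 \<le> a" "a \<le> 1"
  shows "lower h a \<le> lower g a"
  using convex_le_lowerD(2)[OF convex_le int_g] assms by blast

end

section \<open>Construction of the minorant from supporting lines\<close>

text \<open>The minimizers are the contact points of the graph with its supporting line of slope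
  \<open>k\<close>, and they form a compact set. Taking the last one makes the inequality to its
  right strict, which is the source of right continuity of \<open>\<alpha>\<close>.\<close>

lemma largest_minimizer:
  fixes D :: "real \<Rightarrow> real"
  assumes "continuous_on {0..1} D"
  shows "\<exists>a\<in>{0..1}. (\<forall>b\<in>{0..1}. D a - k * a \<le> D b - k * b) \<and> (\<forall>b\<in>{a<..1}. D a - k * a < D b - k * b)"
proof -
  let ?f = "\<lambda>a. D a - k * a"
  have c: "continuous_on {0..1} ?f" using assms by (intro continuous_intros)
  obtain m where m: "m \<in> {0..1}" "\<forall>b\<in>{0..1}. ?f m \<le> ?f b"
    using continuous_attains_inf[OF _ _ c] by auto
  have "closed ({0..1} \<inter> ?f -` {?f m})"
    using c by (intro continuous_closed_preimage) auto
  then have "compact ({0..1} \<inter> ?f -` {?f m})"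
    by (metis (no_types, lifting) closed_Int_compact compact_Icc inf.right_idem inf_commute)
  moreover have "m \<in> {0..1} \<inter> ?f -` {?f m}" using m by simp
  ultimately obtain a where a: "a \<in> {0..1} \<inter> ?f -` {?f m}" "\<forall>b\<in>{0..1} \<inter> ?f -` {?f m}. b \<le> a"
    using compact_attains_sup[of "{0..1} \<inter> ?f -` {?f m}"] by blast
  have "?f a < ?f b" if b: "b \<in> {a<..1}" for b
  proof -
    have "b \<in> {0..1}" using a(1) b by auto
    moreover have "?f b \<noteq> ?f m" using a(2) b \<open>b \<in> {0..1}\<close> by force
    ultimately show ?thesis using a(1) m(2) by force
  qed
  then show ?thesis using a(1) m(2) by (intro bexI[of _ a]) auto
qed

text \<open>The last contact point \<open>\<alpha> k\<close> of the supporting line of slope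
  \<open>k\<close> behaves like a distribution function in \<open>k\<close>, and \<open>g\<close> is
  its generalized inverse. Increments of \<open>lower g\<close> and \<open>D\<close> are matched
  between contact points, and limits in \<open>k\<close> supply the endpoints.\<close>

proposition convex_minorant_exists:
  assumes d: "integrable unif d"
  obtains g \<alpha> where "convex_minorant d g \<alpha>"
proof -
  define D where "D = lower d"
  have cont_D: "continuous_on UNIV D" unfolding D_def by (rule continuous_on_lower[OF d])
  have "\<forall>k. \<exists>a\<in>{0..1}. (\<forall>b\<in>{0..1}. D a - k * a \<le> D b - k * b) \<and> (\<forall>b\<in>{a<..1}. D a - k * a < D b - k * b)"
    using largest_minimizer[OF continuous_on_subset[OF cont_D subset_UNIV]] by blast
  then obtain \<alpha> where "\<forall>k. \<alpha> k \<in> {0..1} \<and> (\<forall>b\<in>{0..1}. D (\<alpha> k) - k * \<alpha> k \<le> D b - k * b) \<and>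
      (\<forall>b\<in>{\<alpha> k<..1}. D (\<alpha> k) - k * \<alpha> k < D b - k * b)"
    by metis
  then have \<alpha>: "\<And>k. 0 \<le> \<alpha> k" "\<And>k. \<alpha> k \<le> 1"
    and opt: "\<And>k b. 0 \<le> b \<Longrightarrow> b \<le> 1 \<Longrightarrow> D (\<alpha> k) - k * \<alpha> k \<le> D b - k * b"
    and strict: "\<And>k b. \<alpha> k < b \<Longrightarrow> b \<le> 1 \<Longrightarrow> D (\<alpha> k) - k * \<alpha> k < D b - k * b"
    by auto
  define B where "B = (\<integral>u. \<bar>d u\<bar> \<partial>unif)"
  have B: "\<bar>D a\<bar> \<le> B" for a unfolding B_def D_def by (rule abs_lower_le[OF d])
  have mono_\<alpha>: "\<alpha> k \<le> \<alpha> l" if "k \<le> l" for k l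
  proof (rule ccontr)
    assume *: "\<not> \<alpha> k \<le> \<alpha> l"
    then have "0 < (k - l) * (\<alpha> k - \<alpha> l)"
      using opt[of "\<alpha> l" k] strict[of l "\<alpha> k"] \<alpha> by (auto simp: algebra_simps)
    then show False using * that by (simp add: zero_less_mult_iff)
  qed
  have ev1: "\<forall>\<^sub>F k in F. \<alpha> k < y" if "1 < y" for F y
    by (rule always_eventually) (use \<alpha>(2) that le_less_trans in blast)
  have ev0: "\<forall>\<^sub>F k in F. y < \<alpha> k" if "y < 0" for F y
    by (rule always_eventually) (use \<alpha>(1) that less_le_trans in blast)
  have right: "(\<alpha> \<longlongrightarrow> \<alpha> k) (at_right k)" for k
  proof (rule order_tendstoI)
    fix y assume "y < \<alpha> k"
    then show "\<forall>\<^sub>F l in at_right k. y < \<alpha> l"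
      unfolding eventually_at_right_field using mono_\<alpha> by (intro exI[of _ "k + 1"]) (auto intro: less_le_trans)
  next
    fix y assume y: "\<alpha> k < y"
    show "\<forall>\<^sub>F l in at_right k. \<alpha> l < y"
    proof (cases "y \<le> 1")
      case True
      \<comment> \<open>On \<open>{y..1}\<close> the tilted function stays above its global minimum
        by some \<open>\<delta> > 0\<close>, so raising the slope by less than
        \<open>\<delta>\<close> cannot move the minimizer to \<open>y\<close> or beyond.\<close>
      have "continuous_on {y..1} (\<lambda>a. D a - k * a)"
        using continuous_on_subset[OF cont_D subset_UNIV] by (intro continuous_intros)
      then obtain b where b: "y \<le> b" "b \<le> 1" and min: "\<And>c. y \<le> c \<Longrightarrow> c \<le> 1 \<Longrightarrow> D b - k * b \<le> D c - k * c"
        using continuous_attains_inf[of "{y..1}" "\<lambda>a. D a - k * a"] True by auto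
      define \<delta> where "\<delta> = D b - k * b - (D (\<alpha> k) - k * \<alpha> k)"
      have "\<delta> > 0" using strict[of k b] b y by (simp add: \<delta>_def)
      have "\<alpha> l < y" if l: "k < l" "l < k + \<delta>" for l
      proof (rule ccontr)
        assume "\<not> \<alpha> l < y"
        then have "\<delta> \<le> (l - k) * (\<alpha> l - \<alpha> k)"
          using min[of "\<alpha> l"] opt[of "\<alpha> k" l] \<alpha> by (simp add: \<delta>_def algebra_simps)
        also have "\<dots> \<le> (l - k) * 1" using l \<alpha>[of l] \<alpha>[of k] by (intro mult_left_mono) auto
        finally show False using l by simp
      qed
      then show ?thesis using \<open>\<delta> > 0\<close> unfolding eventually_at_right_field by (intro exI[of _ "k + \<delta>"]) auto
    qed (simp add: ev1)
  qed
  have top: "(\<alpha> \<longlongrightarrow> 1) at_top"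
  proof (rule order_tendstoI)
    fix y :: real assume y: "y < 1"
    \<comment> \<open>If \<open>\<alpha> k \<le> y\<close>, the supporting line of slope
      \<open>k\<close> would rise by at least \<open>k * (1 - y)\<close> up to 1, whereas
      \<open>D\<close> varies by at most \<open>2 * B\<close>.\<close>
    have "y < \<alpha> k" if k: "max 0 (2 * B / (1 - y)) < k" for k
    proof (rule ccontr)
      assume "\<not> y < \<alpha> k"
      then have "k * (1 - y) \<le> k * (1 - \<alpha> k)" using k by (intro mult_left_mono) auto
      also have "\<dots> \<le> D 1 - D (\<alpha> k)" using opt[of 1 k] by (simp add: algebra_simps)
      also have "\<dots> \<le> 2 * B" using B[of 1] B[of "\<alpha> k"] by linarith
      finally show False using k y by (simp add: pos_divide_less_eq)
    qed
    then show "\<forall>\<^sub>F k in at_top. y < \<alpha> k"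
      using eventually_gt_at_top[of "max 0 (2 * B / (1 - y))"] by (auto elim: eventually_mono)
  qed (rule ev1)
  have bot: "(\<alpha> \<longlongrightarrow> 0) at_bot"
  proof (rule order_tendstoI)
    fix y :: real assume y: "0 < y"
    have "\<alpha> k < y" if k: "k < min 0 (- (2 * B / y))" for k
    proof (rule ccontr)
      assume "\<not> \<alpha> k < y"
      then have "- k * y \<le> - k * \<alpha> k" using k by (intro mult_left_mono) auto
      also have "\<dots> \<le> D 0 - D (\<alpha> k)" using opt[of 0 k] by (simp add: algebra_simps)
      also have "\<dots> \<le> 2 * B" using B[of 0] B[of "\<alpha> k"] by linarith
      finally have "- k \<le> 2 * B / y" using y by (simp add: pos_le_divide_eq)
      then show False using k by simp
    qed
    then show "\<forall>\<^sub>F k in at_bot. \<alpha> k < y"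
      using eventually_gt_at_bot[of "min 0 (- (2 * B / y))"] by (auto elim: eventually_mono)
  qed (rule ev0)
  \<comment> \<open>The pseudo-inverse of this locale assigns to \<open>u\<close> its slope, with
    \<open>g u \<le> k\<close> exactly when \<open>u \<le> \<alpha> k\<close>.\<close>
  interpret right_continuous_mono \<alpha> 0 1
  proof
    show "continuous (at_right k) \<alpha>" for k using right by (simp add: continuous_within)
    show "mono \<alpha>" using mono_\<alpha> by (rule monoI)
  qed (rule bot top)+
  define g where "g = I"
  have g_le: "g u \<le> k \<longleftrightarrow> u \<le> \<alpha> k" if "0 < u" "u < 1" for u k
    unfolding g_def by (rule pseudoinverse[OF that, symmetric])
  have mono_g: "mono_on {0<..<1} g" unfolding g_def by (rule mono_I)
  have [measurable]: "g \<in> borel_measurable unif" by (rule mono_on_measurable_unif[OF mono_g])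
  \<comment> \<open>Between the contact points \<open>\<alpha> k\<close> and
    \<open>\<alpha> l\<close> the values of \<open>g\<close> lie in \<open>{k<..l}\<close>; such a
    piece is integrable before \<open>g\<close> is known to be.\<close>
  define G where "G k l u = indicator {\<alpha> k<..\<alpha> l} u * g u" for k l u
  have G_bounds: "k < g u" "g u \<le> l" if "u \<in> {\<alpha> k<..\<alpha> l}" "0 < u" "u < 1" for k l u
    using that g_le[of u k] g_le[of u l] by (auto simp: not_le[symmetric])
  have int_G: "integrable unif (G k l)" for k l
  proof (rule Bochner_Integration.integrable_bound)
    show "integrable unif (\<lambda>_. max \<bar>k\<bar> \<bar>l\<bar>)" by simp
    show "AE u in unif. norm (G k l u) \<le> norm (max \<bar>k\<bar> \<bar>l\<bar>)"
      using G_bounds[of _ k l] by (intro AE_I2) (force simp: G_def split: split_indicator)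
  qed (simp add: G_def[abs_def])
  have cell: "(\<integral>u. G k l u \<partial>unif) = D (\<alpha> l) - D (\<alpha> k)" if kl: "k \<le> l" for k l
  proof -
    \<comment> \<open>Over \<open>{\<alpha> s<..\<alpha> t}\<close> both increments lie between
      \<open>s * (\<alpha> t - \<alpha> s)\<close> and \<open>t * (\<alpha> t - \<alpha> s)\<close>:
      for \<open>G\<close> by its values, for \<open>D\<close> by the two supporting lines. So the
      mismatch \<open>\<psi>\<close> has a product modulus.\<close>
    define \<psi> where "\<psi> t = lower (G k l) (\<alpha> t) - D (\<alpha> t)" for t
    have "\<psi> l = \<psi> k"
    proof (rule eq_of_product_modulus[OF kl])
      fix s t assume st: "k \<le> s" "s \<le> t" "t \<le> l"
      note le = mono_\<alpha>[OF st(1)] mono_\<alpha>[OF st(2)] mono_\<alpha>[OF st(3)]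
      have eq: "lower (G k l) (\<alpha> t) - lower (G k l) (\<alpha> s) = (\<integral>u. G s t u \<partial>unif)"
        unfolding integral_Ioc_eq[OF int_G le(2), symmetric]
        using le by (intro Bochner_Integration.integral_cong refl) (auto simp: G_def split: split_indicator)
      have "(\<integral>u. indicator {\<alpha> s<..\<alpha> t} u * s \<partial>unif) \<le> (\<integral>u. G s t u \<partial>unif)"
        by (intro integral_mono int_G integrable_unif_indicator)
           (use G_bounds(1)[of _ s t] in \<open>force simp: G_def split: split_indicator\<close>)+
      moreover have "(\<integral>u. G s t u \<partial>unif) \<le> (\<integral>u. indicator {\<alpha> s<..\<alpha> t} u * t \<partial>unif)"
        by (intro integral_mono int_G integrable_unif_indicator)
           (use G_bounds(2)[of _ s t] in \<open>force simp: G_def split: split_indicator\<close>)+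
      ultimately have "s * (\<alpha> t - \<alpha> s) \<le> (\<integral>u. G s t u \<partial>unif)" "(\<integral>u. G s t u \<partial>unif) \<le> t * (\<alpha> t - \<alpha> s)"
        unfolding integral_Ioc_const[OF \<alpha>(1) le(2) \<alpha>(2)] .
      moreover have "s * (\<alpha> t - \<alpha> s) \<le> D (\<alpha> t) - D (\<alpha> s)" "D (\<alpha> t) - D (\<alpha> s) \<le> t * (\<alpha> t - \<alpha> s)"
        using opt[of "\<alpha> t" s] opt[of "\<alpha> s" t] \<alpha> by (simp_all add: algebra_simps)
      ultimately show "\<bar>\<psi> t - \<psi> s\<bar> \<le> (t - s) * (\<alpha> t - \<alpha> s)"
        unfolding \<psi>_def using eq by (simp add: left_diff_distrib)
    qed
    moreover have "(\<integral>u. G k l u \<partial>unif) = lower (G k l) (\<alpha> l) - lower (G k l) (\<alpha> k)"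
      unfolding integral_Ioc_eq[OF int_G mono_\<alpha>[OF kl], symmetric]
      by (intro Bochner_Integration.integral_cong refl) (auto simp: G_def split: split_indicator)
    ultimately show ?thesis by (simp add: \<psi>_def)
  qed
  have int_g: "integrable unif g"
  proof (rule integrableI_bounded)
    \<comment> \<open>The difference of the positive and negative pieces is
      \<open>norm (g u)\<close> as soon as \<open>n\<close> exceeds it; Fatou's lemma then uses the
      bound \<open>4 * B\<close> from the cell increments.\<close>
    have lim: "(\<lambda>n. ennreal (G 0 (real n) u - G (- real n) 0 u)) \<longlonglongrightarrow> ennreal (norm (g u))" if u: "0 < u" "u < 1" for u
    proof (rule tendsto_eventually)
      obtain N :: nat where N: "\<bar>g u\<bar> < real N" using reals_Archimedean2 by blast
      have "G 0 (real n) u - G (- real n) 0 u = norm (g u)" if "n \<ge> N" for n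
      proof -
        have "\<bar>g u\<bar> < real n" using N that by linarith
        then show ?thesis
          using g_le[OF u, of "real n"] g_le[OF u, of "- real n"] g_le[OF u, of 0]
          by (auto simp: G_def split: split_indicator)
      qed
      then show "\<forall>\<^sub>F n in sequentially. ennreal (G 0 (real n) u - G (- real n) 0 u) = ennreal (norm (g u))"
        unfolding eventually_sequentially by (intro exI[of _ N]) auto
    qed
    have "(\<integral>\<^sup>+u. ennreal (norm (g u)) \<partial>unif)
        = (\<integral>\<^sup>+u. liminf (\<lambda>n. ennreal (G 0 (real n) u - G (- real n) 0 u)) \<partial>unif)"
      by (intro nn_integral_cong lim_imp_Liminf[symmetric] lim) auto
    also have "\<dots> \<le> liminf (\<lambda>n. \<integral>\<^sup>+u. ennreal (G 0 (real n) u - G (- real n) 0 u) \<partial>unif)"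
      by (rule nn_integral_liminf) (simp add: G_def[abs_def])
    also have "\<dots> \<le> ennreal (4 * B)"
    proof (rule Liminf_le)
      have "(\<integral>\<^sup>+u. ennreal (G 0 (real n) u - G (- real n) 0 u) \<partial>unif) \<le> ennreal (4 * B)" for n
      proof -
        have "0 \<le> G 0 (real n) u - G (- real n) 0 u" if "u \<in> space unif" for u
          using G_bounds[of u 0 "real n"] G_bounds[of u "- real n" 0] that
          by (auto simp: G_def split: split_indicator)
        then have "(\<integral>\<^sup>+u. ennreal (G 0 (real n) u - G (- real n) 0 u) \<partial>unif)
            = ennreal (\<integral>u. G 0 (real n) u - G (- real n) 0 u \<partial>unif)"
          using int_G by (intro nn_integral_eq_integral) auto
        also have "(\<integral>u. G 0 (real n) u - G (- real n) 0 u \<partial>unif)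
            = D (\<alpha> n) - D (\<alpha> 0) - (D (\<alpha> 0) - D (\<alpha> (- real n)))"
          using int_G by (simp add: cell)
        also have "\<dots> \<le> 4 * B" using B[of "\<alpha> n"] B[of "\<alpha> 0"] B[of "\<alpha> (- real n)"] by linarith
        finally show ?thesis by (simp add: ennreal_leI)
      qed
      then show "\<forall>\<^sub>F n in sequentially. (\<integral>\<^sup>+u. ennreal (G 0 (real n) u - G (- real n) 0 u) \<partial>unif) \<le> ennreal (4 * B)"
        by simp
    qed simp
    finally show "(\<integral>\<^sup>+u. ennreal (norm (g u)) \<partial>unif) < \<infinity>" by (rule le_less_trans) simp
  qed simp
  have cont_g: "continuous_on UNIV (lower g)" by (rule continuous_on_lower[OF int_g])
  have contD: "isCont D a" and contg: "isCont (lower g) a" for a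
    using cont_D cont_g by (auto simp: continuous_on_eq_continuous_at)
  have diff: "lower g (\<alpha> l) - lower g (\<alpha> k) = D (\<alpha> l) - D (\<alpha> k)" if "k \<le> l" for k l
    using integral_Ioc_eq[OF int_g mono_\<alpha>[OF that]] cell[OF that] by (simp add: G_def)
  have contact: "lower g (\<alpha> k) = D (\<alpha> k)" for k
  proof -
    \<comment> \<open>As the slope tends to minus infinity the contact point tends to 0, where both
      primitives vanish, so equal increments become equal values.\<close>
    have 1: "((\<lambda>l. lower g (\<alpha> k) - lower g (\<alpha> l)) \<longlongrightarrow> lower g (\<alpha> k) - lower g 0) at_bot"
      by (intro tendsto_intros isCont_tendsto_compose[OF contg] bot)
    have 2: "((\<lambda>l. D (\<alpha> k) - D (\<alpha> l)) \<longlongrightarrow> D (\<alpha> k) - D 0) at_bot"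
      by (intro tendsto_intros isCont_tendsto_compose[OF contD] bot)
    have "\<forall>\<^sub>F l in at_bot. lower g (\<alpha> k) - lower g (\<alpha> l) = D (\<alpha> k) - D (\<alpha> l)"
      using eventually_le_at_bot[of k] by eventually_elim (rule diff)
    from tendsto_unique[OF trivial_limit_at_bot_linorder Lim_transform_eventually[OF 1 this] 2]
    have "lower g (\<alpha> k) - lower g 0 = D (\<alpha> k) - D 0" .
    then show ?thesis by (simp add: lower_eq_0 D_def)
  qed
  have tot: "(\<integral>u. g u \<partial>unif) = (\<integral>u. d u \<partial>unif)"
  proof -
    have 1: "((\<lambda>l. lower g (\<alpha> l)) \<longlongrightarrow> lower g 1) at_top"
      by (intro isCont_tendsto_compose[OF contg] top)
    have 2: "((\<lambda>l. D (\<alpha> l)) \<longlongrightarrow> D 1) at_top"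
      by (intro isCont_tendsto_compose[OF contD] top)
    have "lower g 1 = D 1"
      using tendsto_unique[OF trivial_limit_at_top_linorder 1[unfolded contact] 2] .
    then show ?thesis by (simp add: lower_eq_integral D_def)
  qed
  have le: "lower g a \<le> D a" if a: "0 < a" "a < 1" for a
  proof -
    \<comment> \<open>From \<open>a\<close> to the contact point \<open>\<alpha> k\<close> the
      values of \<open>g\<close> are at least \<open>k\<close>, so \<open>lower g a\<close> lies
      below the supporting line of slope \<open>k\<close>, and that line lies below
      \<open>D\<close>.\<close>
    define k where "k = g a"
    have ak: "a \<le> \<alpha> k" using g_le[OF a, of k] by (simp add: k_def)
    have "k * (\<alpha> k - a) = (\<integral>u. indicator {a<..\<alpha> k} u * k \<partial>unif)"
      by (rule integral_Ioc_const[symmetric]) (use a ak \<alpha> in auto)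
    also have "\<dots> \<le> (\<integral>u. indicator {a<..\<alpha> k} u * g u \<partial>unif)"
      using int_g a mono_onD[OF mono_g, of a]
      by (intro integral_mono integrable_unif_indicator) (auto simp: k_def split: split_indicator)
    also have "\<dots> = D (\<alpha> k) - lower g a" using integral_Ioc_eq[OF int_g ak] contact by simp
    finally show ?thesis using opt[of a k] a by (simp add: algebra_simps)
  qed
  have "convex_minorant d g \<alpha>"
  proof
    show "lower g a \<le> lower d a" if "0 \<le> a" "a \<le> 1" for a
      using le[of a] that tot unfolding D_def
      by (cases "a = 0 \<or> a = 1") (auto simp: lower_eq_0 lower_eq_integral)
  qed (use d int_g mono_g \<alpha> g_le contact tot in \<open>auto simp: D_def\<close>)
  then show thesis by (rule that)
qed

section \<open>The comonotone coupling\<close>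

text \<open>The positive part of \<open>Z \<omega> - X \<omega>\<close> is the length of
  \<open>{X \<omega>..<Z \<omega>}\<close>; Tonelli exchanges length and probability.\<close>

lemma (in prob_space) nn_integral_diff_eq:
  fixes X Z :: "'a \<Rightarrow> real"
  assumes [measurable]: "X \<in> borel_measurable M" "Z \<in> borel_measurable M"
  shows "(\<integral>\<^sup>+\<omega>. ennreal (Z \<omega> - X \<omega>) \<partial>M) = (\<integral>\<^sup>+t. emeasure M {\<omega>\<in>space M. X \<omega> \<le> t \<and> t < Z \<omega>} \<partial>lborel)"
proof -
  interpret P: pair_sigma_finite M lborel by standard
  define f where "f \<omega> t = (if X \<omega> \<le> t \<and> t < Z \<omega> then 1 else 0 :: ennreal)" for \<omega> t
  have [measurable]: "case_prod f \<in> borel_measurable (M \<Otimes>\<^sub>M lborel)" unfolding f_def by measurable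
  have "(\<integral>\<^sup>+t. f \<omega> t \<partial>lborel) = ennreal (Z \<omega> - X \<omega>)" for \<omega>
  proof -
    have "f \<omega> = indicator {X \<omega>..<Z \<omega>}" by (auto simp: f_def fun_eq_iff split: split_indicator)
    then show ?thesis by (cases "X \<omega> \<le> Z \<omega>") (auto simp: ennreal_neg)
  qed
  moreover have "(\<integral>\<^sup>+\<omega>. f \<omega> t \<partial>M) = emeasure M {\<omega>\<in>space M. X \<omega> \<le> t \<and> t < Z \<omega>}" for t
  proof -
    have "(\<integral>\<^sup>+\<omega>. f \<omega> t \<partial>M) = (\<integral>\<^sup>+\<omega>. indicator {\<omega>\<in>space M. X \<omega> \<le> t \<and> t < Z \<omega>} \<omega> \<partial>M)"
      by (intro nn_integral_cong) (auto simp: f_def split: split_indicator)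
    then show ?thesis by simp
  qed
  ultimately show ?thesis using P.Fubini'[of f] by simp
qed

text \<open>If \<open>X \<le> t\<close>, then either \<open>t < Y + k\<close> or
  \<open>Y \<le> t - k\<close>. The resulting union bound, integrated over \<open>t\<close>, depends
  on the coupling only through its marginals.\<close>

lemma (in prob_space) coupling_hinge_ge:
  fixes X Y :: "'a \<Rightarrow> real"
  assumes [measurable]: "X \<in> borel_measurable M" "Y \<in> borel_measurable M"
  shows "(\<integral>\<^sup>+t. ennreal (measure (distr M borel X) {..t} - measure (distr M borel Y) {..t - k}) \<partial>lborel)
    \<le> (\<integral>\<^sup>+\<omega>. ennreal (k - (X \<omega> - Y \<omega>)) \<partial>M)"
proof -
  have "ennreal (measure (distr M borel X) {..t} - measure (distr M borel Y) {..t - k})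
      \<le> emeasure M {\<omega>\<in>space M. X \<omega> \<le> t \<and> t < Y \<omega> + k}" for t
  proof -
    have "measure (distr M borel X) {..t} = measure M (X -` {..t} \<inter> space M)"
      by (rule measure_distr) auto
    also have "\<dots> \<le> measure M ({\<omega>\<in>space M. X \<omega> \<le> t \<and> t < Y \<omega> + k} \<union> (Y -` {..t - k} \<inter> space M))"
      by (intro finite_measure_mono) auto
    also have "\<dots> \<le> measure M {\<omega>\<in>space M. X \<omega> \<le> t \<and> t < Y \<omega> + k} + measure M (Y -` {..t - k} \<inter> space M)"
      by (rule measure_Un_le) auto
    also have "measure M (Y -` {..t - k} \<inter> space M) = measure (distr M borel Y) {..t - k}"
      by (rule measure_distr[symmetric]) auto
    finally show ?thesis by (simp add: emeasure_eq_measure ennreal_leI)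
  qed
  moreover have "(\<integral>\<^sup>+\<omega>. ennreal (k - (X \<omega> - Y \<omega>)) \<partial>M)
      = (\<integral>\<^sup>+t. emeasure M {\<omega>\<in>space M. X \<omega> \<le> t \<and> t < Y \<omega> + k} \<partial>lborel)"
    using nn_integral_diff_eq[of X "\<lambda>\<omega>. Y \<omega> + k"] by (simp add: algebra_simps)
  ultimately show ?thesis by (simp add: nn_integral_mono)
qed

text \<open>For the comonotone coupling the two events are nested, so the bound is attained.\<close>

lemma comonotone_hinge_eq:
  fixes e r :: "real \<Rightarrow> real"
  assumes e: "mono_on {0<..<1} e" and r: "mono_on {0<..<1} r"
  shows "(\<integral>\<^sup>+u. ennreal (k - (e u - r u)) \<partial>unif) =
    (\<integral>\<^sup>+t. ennreal (measure (distr unif borel e) {..t} - measure (distr unif borel r) {..t - k}) \<partial>lborel)"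
proof -
  note [measurable] = mono_on_measurable_unif[OF e] mono_on_measurable_unif[OF r]
  have "emeasure unif {u\<in>space unif. e u \<le> t \<and> t < r u + k}
      = ennreal (measure (distr unif borel e) {..t} - measure (distr unif borel r) {..t - k})" for t
  proof -
    let ?A = "e -` {..t} \<inter> space unif" and ?B = "r -` {..t - k} \<inter> space unif"
    have AB: "?A \<in> unif.events" "?B \<in> unif.events" by measurable
    have eq: "{u\<in>space unif. e u \<le> t \<and> t < r u + k} = ?A - ?B" by auto
    have meas: "measure (distr unif borel e) {..t} = measure unif ?A"
      "measure (distr unif borel r) {..t - k} = measure unif ?B"
      by (rule measure_distr; simp)+
    \<comment> \<open>Sublevel sets of increasing functions are initial segments of the unit
      interval, so one contains the other.\<close>
    have "?A \<subseteq> ?B \<or> ?B \<subseteq> ?A"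
    proof (rule disjCI, rule subsetI)
      fix u assume "\<not> ?B \<subseteq> ?A" and u: "u \<in> ?A"
      then obtain v where v: "v \<in> ?B" "v \<notin> ?A" by blast
      have "u \<le> v" using u v mono_onD[OF e, of v u] by (intro leI) auto
      then show "u \<in> ?B" using u v mono_onD[OF r, of u v] by auto
    qed
    then show ?thesis
    proof
      assume sub: "?A \<subseteq> ?B"
      then have empty: "?A - ?B = {}" by blast
      have "measure unif ?A \<le> measure unif ?B" by (rule unif.finite_measure_mono[OF sub AB(2)])
      then show ?thesis unfolding eq meas empty by (simp add: ennreal_neg)
    next
      assume sub: "?B \<subseteq> ?A"
      have "measure unif (?A - ?B) = measure unif ?A - measure unif ?B"
        by (rule unif.finite_measure_Diff[OF AB sub])
      then show ?thesis unfolding eq meas unif.emeasure_eq_measure by (rule arg_cong)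
    qed
  qed
  then show ?thesis
    using unif.nn_integral_diff_eq[of e "\<lambda>u. r u + k"] by (simp add: algebra_simps)
qed

lemma nn_integral_hinge:
  fixes X :: "'a \<Rightarrow> real"
  assumes "finite_measure M" "integrable M X"
  shows "(\<integral>\<^sup>+\<omega>. ennreal (k - X \<omega>) \<partial>M) = ennreal (\<integral>\<omega>. max 0 (k - X \<omega>) \<partial>M)"
proof -
  have "(\<integral>\<^sup>+\<omega>. ennreal (k - X \<omega>) \<partial>M) = (\<integral>\<^sup>+\<omega>. ennreal (max 0 (k - X \<omega>)) \<partial>M)"
    by (intro nn_integral_cong) (auto simp: max_def ennreal_neg)
  then show ?thesis
    using nn_integral_eq_integral[OF integrable_hinge[OF assms], of k] by simp
qed

text \<open>The hinge cost of the quantile coupling equals the marginal lower bound valid for every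
  coupling, and the means agree.\<close>

proposition (in prob_space) comonotone_convex_le:
  fixes X Y :: "'a \<Rightarrow> real"
  assumes X: "integrable M X" and Y: "integrable M Y"
    and e: "quantile_of (distr M borel X) e" and r: "quantile_of (distr M borel Y) r"
  shows "distr unif borel (\<lambda>u. e u - r u) \<le>\<^sub>c distr M borel (\<lambda>\<omega>. X \<omega> - Y \<omega>)"
proof (rule convex_le_hingeI)
  have [measurable]: "X \<in> borel_measurable M" "Y \<in> borel_measurable M" using X Y by auto
  have e': "mono_on {0<..<1} e" "integrable unif e" "distr unif borel e = distr M borel X"
    and r': "mono_on {0<..<1} r" "integrable unif r" "distr unif borel r = distr M borel Y"
    using e r by (auto simp: quantile_of_def)
  have [measurable]: "e \<in> borel_measurable unif" "r \<in> borel_measurable unif" using e' r' by auto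
  show "distr unif borel (\<lambda>u. e u - r u) \<in> P1" using e' r' by (intro distr_unif_P1) auto
  show "distr M borel (\<lambda>\<omega>. X \<omega> - Y \<omega>) \<in> P1"
    using X Y by (auto simp: P1_def integrable_distr_eq intro!: prob_space_distr)
  have "(\<integral>x. x \<partial>distr unif borel e) = (\<integral>x. x \<partial>distr M borel X)"
    "(\<integral>x. x \<partial>distr unif borel r) = (\<integral>x. x \<partial>distr M borel Y)"
    using e' r' by simp_all
  then have "(\<integral>u. e u \<partial>unif) = expectation X" "(\<integral>u. r u \<partial>unif) = expectation Y"
    by (simp_all add: integral_distr)
  then show "(\<integral>x. x \<partial>distr unif borel (\<lambda>u. e u - r u)) = (\<integral>x. x \<partial>distr M borel (\<lambda>\<omega>. X \<omega> - Y \<omega>))"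
    using X Y e' r' by (simp add: integral_distr)
  fix k
  have "ennreal (\<integral>u. max 0 (k - (e u - r u)) \<partial>unif) \<le> ennreal (expectation (\<lambda>\<omega>. max 0 (k - (X \<omega> - Y \<omega>))))"
    using comonotone_hinge_eq[OF e'(1) r'(1), of k] coupling_hinge_ge[of X Y k]
      nn_integral_hinge[OF unif.finite_measure_axioms, of "\<lambda>u. e u - r u" k]
      nn_integral_hinge[OF finite_measure_axioms, of "\<lambda>\<omega>. X \<omega> - Y \<omega>" k] e' r' X Y
    by simp
  moreover have "0 \<le> expectation (\<lambda>\<omega>. max 0 (k - (X \<omega> - Y \<omega>)))" by simp
  ultimately have "(\<integral>u. max 0 (k - (e u - r u)) \<partial>unif) \<le> expectation (\<lambda>\<omega>. max 0 (k - (X \<omega> - Y \<omega>)))"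
    by (simp add: ennreal_le_iff)
  then show "(\<integral>x. max 0 (k - x) \<partial>distr unif borel (\<lambda>u. e u - r u))
      \<le> (\<integral>x. max 0 (k - x) \<partial>distr M borel (\<lambda>\<omega>. X \<omega> - Y \<omega>))"
    by (simp add: integral_distr)
qed

text \<open>The law of the pair of quantile functions is a coupling, which bounds the infimum from
  above. Conversely, the difference under any coupling dominates \<open>e u - r u\<close> in convex
  order, which serves all convex costs together.\<close>

lemma W_eq_quantile:
  assumes \<theta>: "convex_on UNIV \<theta>" and e: "quantile_of \<eta> e" and r: "quantile_of \<nu> r"
  shows "W \<theta> \<eta> \<nu> = ext_integral unif (\<lambda>u. \<theta> (e u - r u))"
proof (rule antisym)
  note \<theta>_meas[measurable] = convex_borel_measurable[OF \<theta>]
  have e': "integrable unif e" "distr unif borel e = \<eta>"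
    and r': "integrable unif r" "distr unif borel r = \<nu>"
    using e r by (auto simp: quantile_of_def)
  have [measurable]: "e \<in> borel_measurable unif" "r \<in> borel_measurable unif" using e' r' by auto
  have pair[measurable]: "(\<lambda>u. (e u, r u)) \<in> unif \<rightarrow>\<^sub>M borel" by (rule borel_measurable_Pair) auto
  have sub: "(\<lambda>p. fst p - snd p) \<in> borel_measurable (borel :: (real \<times> real) measure)"
    and proj: "fst \<in> borel_measurable (borel :: (real \<times> real) measure)"
      "snd \<in> borel_measurable (borel :: (real \<times> real) measure)"
    by (intro borel_measurable_continuous_onI continuous_intros)+
  have \<theta>_sub: "(\<lambda>(x, y). \<theta> (x - y)) \<in> borel_measurable borel"
    using measurable_compose[OF sub \<theta>_meas] by (simp add: case_prod_beta)
  define \<pi> where "\<pi> = distr unif borel (\<lambda>u. (e u, r u))"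
  have "distr \<pi> borel fst = \<eta>" "distr \<pi> borel snd = \<nu>"
    unfolding \<pi>_def distr_distr[OF proj(1) pair] distr_distr[OF proj(2) pair] comp_def
    using e'(2) r'(2) by simp_all
  then have "\<pi> \<in> couplings \<eta> \<nu>"
    unfolding couplings_def using unif.prob_space_distr[OF pair] by (simp add: \<pi>_def)
  moreover have "ext_integral \<pi> (\<lambda>(x, y). \<theta> (x - y)) = ext_integral unif (\<lambda>u. \<theta> (e u - r u))"
    unfolding \<pi>_def using ext_integral_distr[OF \<theta>_sub pair] by simp
  ultimately show "W \<theta> \<eta> \<nu> \<le> ext_integral unif (\<lambda>u. \<theta> (e u - r u))"
    unfolding W_def by (intro INF_lower2[of \<pi>]) auto
  show "ext_integral unif (\<lambda>u. \<theta> (e u - r u)) \<le> W \<theta> \<eta> \<nu>"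
    unfolding W_def
  proof (rule INF_greatest)
    fix \<pi> assume \<pi>: "\<pi> \<in> couplings \<eta> \<nu>"
    interpret prob_space \<pi> using \<pi> by (simp add: couplings_def)
    have sets: "sets \<pi> = sets borel" using \<pi> by (simp add: couplings_def)
    have d: "distr \<pi> borel fst = \<eta>" "distr \<pi> borel snd = \<nu>" using \<pi> by (auto simp: couplings_def)
    have meas: "f \<in> borel_measurable \<pi>" if "f \<in> borel_measurable borel" for f :: "_ \<Rightarrow> real"
      using that measurable_cong_sets[OF sets refl] by blast
    have "integrable (distr \<pi> borel fst) (\<lambda>x. x)" "integrable (distr \<pi> borel snd) (\<lambda>x. x)"
      using P1_D(3)[OF distr_unif_P1[OF e'(1)]] P1_D(3)[OF distr_unif_P1[OF r'(1)]]
      unfolding d e'(2) r'(2) by auto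
    then have int: "integrable \<pi> fst" "integrable \<pi> snd"
      using integrable_distr[OF meas[OF proj(1)], of "\<lambda>x. x"] integrable_distr[OF meas[OF proj(2)], of "\<lambda>x. x"]
      by blast+
    have "ext_integral (distr unif borel (\<lambda>u. e u - r u)) \<theta> \<le> ext_integral (distr \<pi> borel (\<lambda>p. fst p - snd p)) \<theta>"
      using comonotone_convex_le[OF int, of e r] e r \<theta> unfolding d convex_le_def by simp
    then show "ext_integral unif (\<lambda>u. \<theta> (e u - r u)) \<le> ext_integral \<pi> (\<lambda>(x, y). \<theta> (x - y))"
      using ext_integral_distr[OF \<theta>_meas meas[OF sub]] by (simp add: ext_integral_distr case_prod_beta')
  qed
qed

section \<open>The smallest dominating measure\<close>

lemma strictly_convex_imp_convex:
  assumes "strictly_convex \<theta>"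
  shows "convex_on UNIV \<theta>"
proof (rule convex_onI)
  fix t x y :: real assume "0 < t" "t < 1"
  then show "\<theta> ((1 - t) *\<^sub>R x + t *\<^sub>R y) \<le> (1 - t) * \<theta> x + t * \<theta> y"
    using assms[unfolded strictly_convex_def, rule_format, of x y t]
    by (cases "x = y") (auto simp: algebra_simps)
qed simp

section \<open>Increasing 1-Lipschitz maps\<close>

lemma increasing_1_LipschitzD:
  assumes "increasing_1_Lipschitz S"
  shows "mono S" "x \<le> y \<Longrightarrow> S y - S x \<le> y - x" "S \<in> borel_measurable borel"
proof -
  show mono: "mono S" using assms by (simp add: increasing_1_Lipschitz_def)
  have "1-lipschitz_on UNIV S" using assms by (simp add: increasing_1_Lipschitz_def)
  then have "dist (S x) (S y) \<le> 1 * dist x y" by (rule lipschitz_onD) auto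
  then show "x \<le> y \<Longrightarrow> S y - S x \<le> y - x" by (simp add: dist_real_def abs_le_iff)
  show "S \<in> borel_measurable borel" using mono by (rule borel_measurable_mono)
qed

lemma increasing_1_LipschitzI:
  assumes "\<And>x y. x \<le> y \<Longrightarrow> S x \<le> S y" "\<And>x y. x \<le> y \<Longrightarrow> S y - S x \<le> y - x"
  shows "increasing_1_Lipschitz S"
  unfolding increasing_1_Lipschitz_def
proof (intro conjI monoI lipschitz_onI)
  show "dist (S x) (S y) \<le> 1 * dist x y" for x y
    using assms[of x y] assms[of y x] by (cases "x \<le> y") (auto simp: dist_real_def abs_le_iff)
qed (use assms in auto)

lemma increasing_1_Lipschitz_compose:
  assumes S: "increasing_1_Lipschitz S" and e: "mono_on {0<..<1} e" "integrable unif e"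
  shows "mono_on {0<..<1} (\<lambda>u. S (e u))" "mono_on {0<..<1} (\<lambda>u. e u - S (e u))"
    "integrable unif (\<lambda>u. S (e u))"
proof -
  note S' = increasing_1_LipschitzD[OF S]
  show "mono_on {0<..<1} (\<lambda>u. S (e u))"
    using mono_onD[OF e(1)] monoD[OF S'(1)] by (intro mono_onI) blast
  show "mono_on {0<..<1} (\<lambda>u. e u - S (e u))"
  proof (rule mono_onI)
    fix u v :: real assume "u \<in> {0<..<1}" "v \<in> {0<..<1}" "u \<le> v"
    then have "e u \<le> e v" by (rule mono_onD[OF e(1)])
    then show "e u - S (e u) \<le> e v - S (e v)" using S'(2)[of "e u" "e v"] by simp
  qed
  have [measurable]: "S \<in> borel_measurable borel" "e \<in> borel_measurable unif" using S' e by auto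
  show "integrable unif (\<lambda>u. S (e u))"
  proof (rule Bochner_Integration.integrable_bound)
    show "integrable unif (\<lambda>u. \<bar>S 0\<bar> + \<bar>e u\<bar>)" using e by auto
    have "\<bar>S x\<bar> \<le> \<bar>S 0\<bar> + \<bar>x\<bar>" for x
      using S'(2)[of 0 x] S'(2)[of x 0] monoD[OF S'(1), of 0 x] monoD[OF S'(1), of x 0]
      by (cases "0 \<le> x") auto
    then show "AE u in unif. norm (S (e u)) \<le> norm (\<bar>S 0\<bar> + \<bar>e u\<bar>)" by (intro AE_I2) force
  qed measurable
qed

lemma distr_quantile_compose:
  assumes "quantile_of \<eta> e" "S \<in> borel_measurable borel"
  shows "distr \<eta> borel S = distr unif borel (\<lambda>u. S (e u))"
proof -
  have "\<eta> = distr unif borel e" "e \<in> borel_measurable unif" using assms by (auto simp: quantile_of_def)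
  then show ?thesis using assms(2) by (simp add: distr_distr comp_def)
qed

text \<open>A McShane-type extension: \<open>F x u\<close> is the maximum of \<open>r u\<close> and
  \<open>x - g u\<close>, increasing and 1-Lipschitz in \<open>x\<close>, and the infimum over
  \<open>u\<close> keeps both properties. At \<open>x = g u + r u\<close>, every
  \<open>F x v\<close> is at least \<open>r u\<close>: through \<open>g\<close> for
  \<open>v \<le> u\<close> and through \<open>r\<close> otherwise.\<close>

lemma increasing_1_Lipschitz_interpolation:
  fixes g r :: "real \<Rightarrow> real"
  assumes g: "mono_on {0<..<1} g" and r: "mono_on {0<..<1} r"
  obtains T where "increasing_1_Lipschitz T" "\<And>u. u \<in> {0<..<1} \<Longrightarrow> T (g u + r u) = r u"
proof -
  define F where "F x u = r u + max 0 (x - (g u + r u))" for x u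
  define T where "T x = (INF u\<in>{0<..<1}. F x u)" for x
  have bdd: "bdd_below (F x ` {0<..<1})" for x
  proof (rule bdd_belowI2)
    fix u :: real assume u: "u \<in> {0<..<1}"
    \<comment> \<open>The split point \<open>1/2\<close> is an arbitrary interior point: to its left
      the branch \<open>x - g u\<close> is bounded below, to its right the branch
      \<open>r u\<close>.\<close>
    show "min (x - g (1/2)) (r (1/2)) \<le> F x u"
    proof (cases "u \<le> 1/2")
      case True
      then have "g u \<le> g (1/2)" using u by (intro mono_onD[OF g]) auto
      then show ?thesis by (simp add: F_def max_def min_def)
    next
      case False
      then have "r (1/2) \<le> r u" using u by (intro mono_onD[OF r]) auto
      then show ?thesis by (simp add: F_def max_def min_def)
    qed
  qed
  have lower: "T x \<le> F x u" if "u \<in> {0<..<1}" for x u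
    unfolding T_def by (rule cINF_lower[OF bdd that])
  have greatest: "c \<le> T x" if "\<And>u. u \<in> {0<..<1} \<Longrightarrow> c \<le> F x u" for c x
    unfolding T_def using that by (intro cINF_greatest) auto
  show thesis
  proof (rule that)
    show "increasing_1_Lipschitz T"
    proof (rule increasing_1_LipschitzI)
      fix x y :: real assume xy: "x \<le> y"
      show "T x \<le> T y"
      proof (rule greatest)
        fix u :: real assume "u \<in> {0<..<1}"
        then show "T x \<le> F y u" using lower[of u x] xy by (simp add: F_def max_def split: if_splits)
      qed
      have "T y - (y - x) \<le> T x"
      proof (rule greatest)
        fix u :: real assume "u \<in> {0<..<1}"
        then show "T y - (y - x) \<le> F x u" using lower[of u y] xy by (simp add: F_def max_def split: if_splits)
      qed
      then show "T y - T x \<le> y - x" by simp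
    qed
    fix u :: real assume u: "u \<in> {0<..<1}"
    show "T (g u + r u) = r u"
    proof (rule antisym)
      show "T (g u + r u) \<le> r u" using lower[OF u, of "g u + r u"] by (simp add: F_def)
      show "r u \<le> T (g u + r u)"
      proof (rule greatest)
        fix v :: real assume v: "v \<in> {0<..<1}"
        show "r u \<le> F (g u + r u) v"
          using mono_onD[OF g v u] mono_onD[OF r u v] by (cases "v \<le> u") (auto simp: F_def max_def)
      qed
    qed
  qed
qed

lemma convex_le_quantile_lower:
  assumes "\<eta> \<le>\<^sub>c \<nu>" "quantile_of \<eta> e" "quantile_of \<nu> f"
  shows "(\<integral>u. e u \<partial>unif) = (\<integral>u. f u \<partial>unif)"
    and "0 \<le> a \<Longrightarrow> a \<le> 1 \<Longrightarrow> lower f a \<le> lower e a"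
  using convex_le_lowerD[of e f] assms by (auto simp: quantile_of_def)

section \<open>Potentials and sublevel points\<close>

text \<open>Integrates \<open>\<bar>t\<bar> = 2 * max 0 (- t) + t\<close>. For laws of equal mean,
  potentials agree at \<open>y\<close> exactly when the hinge integrals do.\<close>

lemma potential_eq_hinge:
  assumes "integrable unif f"
  shows "potential (distr unif borel f) y = 2 * (\<integral>u. max 0 (y - f u) \<partial>unif) + (\<integral>u. f u \<partial>unif) - y"
proof -
  have [measurable]: "f \<in> borel_measurable unif" using assms by auto
  have "potential (distr unif borel f) y = (\<integral>u. \<bar>f u - y\<bar> \<partial>unif)"
    unfolding potential_def by (subst integral_distr) auto
  also have "\<dots> = (\<integral>u. 2 * max 0 (y - f u) + f u - y \<partial>unif)"
    by (intro Bochner_Integration.integral_cong refl) (auto simp: max_def)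
  also have "\<dots> = 2 * (\<integral>u. max 0 (y - f u) \<partial>unif) + (\<integral>u. f u \<partial>unif) - y"
    using assms integrable_hinge[OF unif.finite_measure_axioms assms, of y]
    by (simp add: unif.prob_space[simplified])
  finally show ?thesis .
qed

text \<open>\<open>z\<close> is the last point at level \<open>k\<close>; the Lipschitz bound gives
  the continuity that puts \<open>z\<close> itself on that level.\<close>

lemma sublevel_point:
  fixes c :: "real \<Rightarrow> real"
  assumes mono: "\<And>x y. x \<le> y \<Longrightarrow> c x \<le> c y" and lip: "\<And>x y. x \<le> y \<Longrightarrow> c y - c x \<le> y - x"
    and xy: "c x \<le> k" "k < c y"
  obtains z where "x \<le> z" "z < y" "c z = k" "\<And>w. c w \<le> k \<longleftrightarrow> w \<le> z"
proof -
  let ?S = "{x. c x \<le> k}"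
  define z where "z = Sup ?S"
  have bdd: "bdd_above ?S"
  proof (rule bdd_aboveI)
    fix w assume "w \<in> ?S"
    then have "c w < c y" using xy by simp
    then show "w \<le> y" using mono[of y w] by (intro leI) force
  qed
  have upper: "w \<le> z" if "c w \<le> k" for w unfolding z_def using bdd that by (intro cSup_upper) auto
  have "c z \<le> k + \<epsilon>" if "0 < \<epsilon>" for \<epsilon>
  proof -
    have "z - \<epsilon> < Sup ?S" using that by (simp add: z_def)
    then obtain w where w: "c w \<le> k" "z - \<epsilon> < w" using xy(1) less_cSupD[of ?S] by auto
    then show ?thesis using lip[OF upper[OF w(1)]] by simp
  qed
  then have le: "c z \<le> k" by (rule field_le_epsilon)
  have "k \<le> c z + \<epsilon>" if "0 < \<epsilon>" for \<epsilon>
  proof -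
    have "k < c (z + \<epsilon>)" using upper[of "z + \<epsilon>"] that by force
    then show ?thesis using lip[of z "z + \<epsilon>"] that by simp
  qed
  then have ge: "k \<le> c z" by (rule field_le_epsilon)
  have iff: "c w \<le> k \<longleftrightarrow> w \<le> z" for w using upper[of w] mono[of w z] le by auto
  then show thesis using that[of z] xy le ge by (metis antisym not_le)
qed

section \<open>The candidate measure in quantile coordinates and its minimality\<close>

locale quantile_minorant = convex_minorant "\<lambda>u. q u - r u" g \<alpha>
  for q r g \<alpha> :: "real \<Rightarrow> real" +
  fixes \<mu> \<nu> :: "real measure"
  assumes q: "quantile_of \<mu> q" and r: "quantile_of \<nu> r"
begin

text \<open>Its gap to \<open>r\<close> is the increasing function \<open>g\<close>, which is what
  allows an increasing 1-Lipschitz map to carry \<open>q_star\<close> to \<open>r\<close>.\<close>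

definition q_star :: "real \<Rightarrow> real" where
  "q_star u = g u + r u"

definition \<nu>_star :: "real measure" where
  "\<nu>_star = distr unif borel q_star"

lemma q': "mono_on {0<..<1} q" "integrable unif q" "distr unif borel q = \<mu>"
  and r': "mono_on {0<..<1} r" "integrable unif r" "distr unif borel r = \<nu>"
  using q r by (auto simp: quantile_of_def)

lemma P1_marginals: "\<mu> \<in> P1" "\<nu> \<in> P1"
  using distr_unif_P1[OF q'(2)] distr_unif_P1[OF r'(2)] by (auto simp: q' r')

lemma quantiles_measurable [measurable]: "q \<in> borel_measurable unif" "r \<in> borel_measurable unif" "g \<in> borel_measurable unif"
  using q' r' int_g by auto

lemma q_star: "quantile_of \<nu>_star q_star"
  unfolding quantile_of_def \<nu>_star_def
proof (intro conjI refl)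
  show "mono_on {0<..<1} q_star"
    unfolding q_star_def using mono_onD[OF mono_g] mono_onD[OF r'(1)] by (intro mono_onI add_mono) auto
  show "integrable unif q_star" unfolding q_star_def using int_g r' by simp
qed

lemma q_star': "mono_on {0<..<1} q_star" "integrable unif q_star" "q_star \<in> borel_measurable unif"
  using q_star by (auto simp: quantile_of_def)

lemma \<nu>_star_P1: "\<nu>_star \<in> P1"
  unfolding \<nu>_star_def by (rule distr_unif_P1[OF q_star'(2)])

lemma lower_q_star: "lower q_star a = lower g a + lower r a"
  unfolding q_star_def by (rule lower_add[OF int_g r'(2)])

lemma lower_d: "lower (\<lambda>u. q u - r u) a = lower q a - lower r a"
  using q' r' by (intro lower_diff)

lemma integral_g: "(\<integral>u. g u \<partial>unif) = (\<integral>u. q u \<partial>unif) - (\<integral>u. r u \<partial>unif)"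
  using total q' r' by simp

lemma integral_q_star: "(\<integral>u. q_star u \<partial>unif) = (\<integral>u. q u \<partial>unif)"
  unfolding q_star_def using integral_g int_g r' by simp

lemma \<mu>_le_\<nu>_star: "\<mu> \<le>\<^sub>c \<nu>_star"
proof -
  have "distr unif borel q \<le>\<^sub>c distr unif borel q_star"
  proof (rule convex_le_lowerI[OF q'(1,2) q_star'(2)])
    show "lower q_star a \<le> lower q a" if "0 < a" "a < 1" for a
      using lower_le[of a] that by (simp add: lower_q_star lower_d)
  qed (simp add: integral_q_star)
  then show ?thesis by (simp add: \<nu>_star_def q')
qed

lemma \<nu>_star_dominating: "\<nu>_star \<in> dominating \<mu>"
  using \<mu>_le_\<nu>_star \<nu>_star_P1 by (simp add: dominating_def)

text \<open>Both sides are increasing in \<open>u\<close> and have law \<open>\<nu>\<close>, so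
  uniqueness of quantile functions applies.\<close>

lemma pushes_onto_AE:
  assumes S: "increasing_1_Lipschitz S" "pushes_onto S \<eta> \<nu>" and e: "quantile_of \<eta> e"
  shows "AE u in unif. S (e u) = r u"
proof (rule mono_on_distr_unique)
  show "mono_on {0<..<1} (\<lambda>u. S (e u))"
    using increasing_1_Lipschitz_compose[OF S(1)] e by (auto simp: quantile_of_def)
  show "distr unif borel (\<lambda>u. S (e u)) = distr unif borel r"
    using distr_quantile_compose[OF e increasing_1_LipschitzD(3)[OF S(1)]] S(2)
    by (simp add: pushes_onto_def r')
qed (rule r')

text \<open>The gap \<open>h u = e u - S (e u)\<close> is increasing because \<open>S\<close> is
  1-Lipschitz, and the convex order puts its primitive below that of \<open>q - r\<close>.
  Maximality of the minorant gives \<open>lower h \<le> lower g\<close>, and adding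
  \<open>lower r\<close> compares \<open>e\<close> with \<open>q_star\<close>.\<close>

lemma \<nu>_star_least:
  assumes \<eta>: "\<eta> \<in> dominating \<mu>" and S: "increasing_1_Lipschitz S" "pushes_onto S \<eta> \<nu>"
  shows "\<nu>_star \<le>\<^sub>c \<eta>"
proof -
  have le: "\<mu> \<le>\<^sub>c \<eta>" and "\<eta> \<in> P1" using \<eta> by (auto simp: dominating_def)
  then obtain e where e: "quantile_of \<eta> e" using quantile_of_exists by blast
  have e': "mono_on {0<..<1} e" "integrable unif e" "distr unif borel e = \<eta>"
    using e by (auto simp: quantile_of_def)
  note Se = increasing_1_Lipschitz_compose[OF S(1) e'(1,2)]
  have AE: "AE u in unif. S (e u) = r u" by (rule pushes_onto_AE[OF S e])
  have lowerS: "lower (\<lambda>u. S (e u)) a = lower r a" for a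
    using AE Se r' by (intro lower_cong_AE) auto
  have intS: "(\<integral>u. S (e u) \<partial>unif) = (\<integral>u. r u \<partial>unif)"
    using AE Se r' by (intro integral_cong_AE) auto
  note qe = convex_le_quantile_lower[OF le q e]
  define h where "h u = e u - S (e u)" for u
  have h: "mono_on {0<..<1} h" "integrable unif h" using Se e' by (simp_all add: h_def[abs_def])
  have lower_h: "lower h a = lower e a - lower r a" for a
    unfolding h_def using e' Se by (simp add: lower_diff lowerS)
  have hg: "lower h a \<le> lower g a" if a: "0 \<le> a" "a \<le> 1" for a
  proof (rule lower_maximal[OF h _ _ a])
    show "(\<integral>u. h u \<partial>unif) = (\<integral>u. q u - r u \<partial>unif)"
      using e' Se q' r' qe(1) intS by (simp add: h_def)
    show "lower h a \<le> lower (\<lambda>u. q u - r u) a" if "0 \<le> a" "a \<le> 1" for a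
      using qe(2)[OF that] by (simp add: lower_h lower_d)
  qed
  have "distr unif borel q_star \<le>\<^sub>c distr unif borel e"
  proof (rule convex_le_lowerI[OF q_star'(1,2) e'(2)])
    show "lower e a \<le> lower q_star a" if "0 < a" "a < 1" for a
      using hg[of a] that by (simp add: lower_h lower_q_star)
  qed (simp add: integral_q_star qe(1))
  then show ?thesis by (simp add: \<nu>_star_def e')
qed

section \<open>Optimality for convex costs and uniqueness for strictly convex ones\<close>

text \<open>The common source of the cost bounds: gaps from dominating measures, gaps from measures
  below \<open>\<nu>\<close>, and midpoints of gaps all serve as \<open>h\<close>.\<close>

lemma ext_integral_g_le:
  assumes \<theta>: "convex_on UNIV \<theta>" and h: "integrable unif h"
    and tot: "(\<integral>u. h u \<partial>unif) = (\<integral>u. q u - r u \<partial>unif)"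
    and le: "\<And>a. 0 \<le> a \<Longrightarrow> a \<le> 1 \<Longrightarrow> lower h a \<le> lower q a - lower r a"
  shows "ext_integral unif (\<lambda>u. \<theta> (g u)) \<le> ext_integral unif (\<lambda>u. \<theta> (h u))"
proof -
  have "ext_integral (distr unif borel g) \<theta> \<le> ext_integral (distr unif borel h) \<theta>"
    using convex_le[OF h tot] le \<theta> unfolding convex_le_def by (simp add: lower_d)
  then show ?thesis
    using convex_borel_measurable[OF \<theta>] h int_g by (simp add: ext_integral_distr)
qed

lemma W_\<nu>_star: "convex_on UNIV \<theta> \<Longrightarrow> W \<theta> \<nu>_star \<nu> = ext_integral unif (\<lambda>u. \<theta> (g u))"
  using W_eq_quantile[OF _ q_star r] by (simp add: q_star_def)

lemma dominating_gap:
  assumes "\<eta> \<in> dominating \<mu>" "quantile_of \<eta> e"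
  shows "integrable unif (\<lambda>u. e u - r u)"
    "(\<integral>u. e u - r u \<partial>unif) = (\<integral>u. q u - r u \<partial>unif)"
    "0 \<le> a \<Longrightarrow> a \<le> 1 \<Longrightarrow> lower (\<lambda>u. e u - r u) a \<le> lower q a - lower r a"
  using convex_le_quantile_lower[OF _ q assms(2)] assms q' r'
  by (auto simp: dominating_def quantile_of_def lower_diff)

lemma W_ge:
  assumes \<theta>: "convex_on UNIV \<theta>" and \<eta>: "\<eta> \<in> dominating \<mu>"
  shows "W \<theta> \<nu>_star \<nu> \<le> W \<theta> \<eta> \<nu>"
proof -
  obtain e where e: "quantile_of \<eta> e" using quantile_of_exists \<eta> by (auto simp: dominating_def)
  show ?thesis
    unfolding W_\<nu>_star[OF \<theta>] W_eq_quantile[OF \<theta> e r]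
    by (rule ext_integral_g_le[OF \<theta> dominating_gap[OF \<eta> e]])
qed

text \<open>For a measure below \<open>\<nu>\<close> with quantile function \<open>f\<close>,
  \<open>lower r \<le> lower f\<close> puts the primitive of \<open>q - f\<close> below that of
  \<open>q - r\<close>. This transfers finiteness of \<open>V\<close> to the optimal cost.\<close>

lemma V_ge:
  assumes \<theta>: "convex_on UNIV \<theta>"
  shows "W \<theta> \<nu>_star \<nu> \<le> V \<theta> \<mu> \<nu>"
  unfolding V_def
proof (rule INF_greatest)
  fix \<rho> assume \<rho>: "\<rho> \<in> {\<eta> \<in> P1. \<eta> \<le>\<^sub>c \<nu>}"
  then obtain f where f: "quantile_of \<rho> f" using quantile_of_exists by auto
  have f': "integrable unif f" using f by (simp add: quantile_of_def)
  note fr = convex_le_quantile_lower[OF _ f r]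
  show "W \<theta> \<nu>_star \<nu> \<le> W \<theta> \<mu> \<rho>"
    unfolding W_\<nu>_star[OF \<theta>] W_eq_quantile[OF \<theta> q f]
    using \<rho> fr q' r' f' by (intro ext_integral_g_le[OF \<theta>]) (auto simp: lower_diff)
qed

lemma \<nu>_star_optimizer:
  assumes "convex_on UNIV \<theta>"
  shows "is_optimizer \<theta> \<mu> \<nu> \<nu>_star"
  unfolding is_optimizer_def
  using \<nu>_star_dominating W_ge[OF assms] by (auto intro!: antisym INF_greatest INF_lower)

text \<open>If \<open>e - r\<close> were a second optimal gap, then the average of \<open>e - r\<close> and \<open>g\<close> would be a competitor of
  strictly smaller cost.\<close>

lemma optimizer_unique:
  assumes strict: "strictly_convex \<theta>" and fin: "\<bar>V \<theta> \<mu> \<nu>\<bar> \<noteq> \<infinity>" and opt: "is_optimizer \<theta> \<mu> \<nu> \<eta>"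
  shows "\<eta> = \<nu>_star"
proof -
  have \<theta>: "convex_on UNIV \<theta>" by (rule strictly_convex_imp_convex[OF strict])
  note [measurable] = convex_borel_measurable[OF \<theta>]
  have \<eta>: "\<eta> \<in> dominating \<mu>" using opt by (simp add: is_optimizer_def)
  obtain e where e: "quantile_of \<eta> e" using quantile_of_exists \<eta> by (auto simp: dominating_def)
  have e': "mono_on {0<..<1} e" "integrable unif e" "distr unif borel e = \<eta>"
    using e by (auto simp: quantile_of_def)
  define h where "h u = e u - r u" for u
  note h = dominating_gap[OF \<eta> e, folded h_def]
  have int_h: "integrable unif h" using h(1) by (simp add: h_def[abs_def])
  have [measurable]: "h \<in> borel_measurable unif" using int_h by auto
  note ext = ext_integral_convex[OF unif.finite_measure_axioms _ \<theta>]
  have "W \<theta> \<eta> \<nu> = W \<theta> \<nu>_star \<nu>"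
    using opt \<nu>_star_optimizer[OF \<theta>] by (simp add: is_optimizer_def)
  then have eq: "ext_integral unif (\<lambda>u. \<theta> (h u)) = ext_integral unif (\<lambda>u. \<theta> (g u))"
    using W_eq_quantile[OF \<theta> e r] W_\<nu>_star[OF \<theta>] by (simp add: h_def)
  have "ext_integral unif (\<lambda>u. \<theta> (g u)) \<noteq> \<infinity>"
    using V_ge[OF \<theta>] fin unfolding W_\<nu>_star[OF \<theta>] by auto
  then have int_\<theta>: "integrable unif (\<lambda>u. \<theta> (g u))" "integrable unif (\<lambda>u. \<theta> (h u))"
    using ext[OF int_g] ext[OF int_h] eq by (auto split: if_splits)
  then have same: "(\<integral>u. \<theta> (h u) \<partial>unif) = (\<integral>u. \<theta> (g u) \<partial>unif)"
    using eq ext[OF int_g] ext[OF int_h] by simp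
  define m where "m u = (1/2) * (h u + g u)" for u
  have int_m: "integrable unif m" unfolding m_def using int_h int_g by simp
  have [measurable]: "m \<in> borel_measurable unif" using int_m by auto
  have conv: "\<theta> ((1/2) * (x + y)) \<le> (\<theta> x + \<theta> y) / 2" for x y
    using convex_onD[OF \<theta>, of "1/2" x y] by (simp add: algebra_simps add_divide_distrib)
  have lower_m: "lower m a = (1/2) * (lower h a + lower g a)" for a
    unfolding m_def lower_cmult using int_h int_g by (simp add: lower_add)
  have le: "ext_integral unif (\<lambda>u. \<theta> (g u)) \<le> ext_integral unif (\<lambda>u. \<theta> (m u))"
  proof (rule ext_integral_g_le[OF \<theta> int_m])
    show "(\<integral>u. m u \<partial>unif) = (\<integral>u. q u - r u \<partial>unif)"
      unfolding m_def using h(2) total int_h int_g by simp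
    show "lower m a \<le> lower q a - lower r a" if "0 \<le> a" "a \<le> 1" for a
      using h(3)[OF that] lower_le[OF that] unfolding lower_m lower_d by (simp add: h_def[abs_def])
  qed
  obtain \<psi> where \<psi>: "\<And>x y. \<theta> x + \<psi> x * (y - x) \<le> \<theta> y" using convex_subgradient[OF \<theta>] by blast
  have int_\<theta>m: "integrable unif (\<lambda>u. \<theta> (m u))"
  proof (rule Bochner_Integration.integrable_bound)
    show "integrable unif (\<lambda>u. \<bar>(\<theta> (h u) + \<theta> (g u)) / 2\<bar> + \<bar>\<theta> 0 + \<psi> 0 * m u\<bar>)"
      using int_\<theta> int_m by auto
    have *: "\<bar>b\<bar> \<le> \<bar>a\<bar> + \<bar>c\<bar>" if "b \<le> a" "c \<le> b" for a b c :: real using that by linarith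
    have "\<bar>\<theta> (m u)\<bar> \<le> \<bar>(\<theta> (h u) + \<theta> (g u)) / 2\<bar> + \<bar>\<theta> 0 + \<psi> 0 * m u\<bar>" for u
      using conv \<psi>[of 0 "m u"] by (intro *) (auto simp: m_def)
    then show "AE u in unif. norm (\<theta> (m u)) \<le> norm (\<bar>(\<theta> (h u) + \<theta> (g u)) / 2\<bar> + \<bar>\<theta> 0 + \<psi> 0 * m u\<bar>)"
      by (intro AE_I2) simp
  qed measurable
  \<comment> \<open>The Jensen defect at the midpoint is nonnegative, while optimality of
    \<open>g\<close> makes its integral at most 0. It therefore vanishes almost everywhere, and
    strict convexity forces \<open>h u = g u\<close> there.\<close>
  define gap where "gap u = (\<theta> (h u) + \<theta> (g u)) / 2 - \<theta> (m u)" for u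
  have gap_nonneg: "0 \<le> gap u" for u using conv by (simp add: gap_def m_def)
  have int_gap: "integrable unif gap" unfolding gap_def using int_\<theta> int_\<theta>m by simp
  have "(\<integral>u. \<theta> (g u) \<partial>unif) \<le> (\<integral>u. \<theta> (m u) \<partial>unif)"
    using le ext[OF int_g] ext[OF int_m] int_\<theta> int_\<theta>m by simp
  then have "(\<integral>u. gap u \<partial>unif) \<le> 0" unfolding gap_def using int_\<theta> int_\<theta>m same by simp
  moreover have "0 \<le> (\<integral>u. gap u \<partial>unif)" using gap_nonneg by simp
  ultimately have "(\<integral>u. gap u \<partial>unif) = 0" by (rule antisym)
  then have "AE u in unif. gap u = 0"
    using integral_nonneg_eq_0_iff_AE[OF int_gap AE_I2[OF gap_nonneg]] by blast
  then have "AE u in unif. e u = q_star u"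
  proof eventually_elim
    fix u assume "gap u = 0"
    then have "h u = g u"
      using strict[unfolded strictly_convex_def, rule_format, of "h u" "g u" "1/2"]
      by (cases "h u = g u") (auto simp: gap_def m_def algebra_simps add_divide_distrib)
    then show "e u = q_star u" by (simp add: h_def q_star_def)
  qed
  then have "distr unif borel e = distr unif borel q_star"
    using e' q_star' by (intro distr_cong_AE) auto
  then show ?thesis by (simp add: e' \<nu>_star_def)
qed

section \<open>Maps pushing the smallest measure onto the target, and their slope\<close>

lemma pushes_\<nu>_star_iff:
  assumes "increasing_1_Lipschitz S"
  shows "pushes_onto S \<nu>_star \<nu> \<longleftrightarrow> (AE u in unif. S (q_star u) = r u)"
proof
  assume "AE u in unif. S (q_star u) = r u"
  then have "distr unif borel (\<lambda>u. S (q_star u)) = distr unif borel r"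
    using increasing_1_Lipschitz_compose(3)[OF assms q_star'(1,2)] r' by (intro distr_cong_AE) auto
  then show "pushes_onto S \<nu>_star \<nu>"
    using distr_quantile_compose[OF q_star increasing_1_LipschitzD(3)[OF assms]] by (simp add: pushes_onto_def r')
qed (rule pushes_onto_AE[OF assms _ q_star])

lemma push_exists:
  obtains T where "increasing_1_Lipschitz T" "pushes_onto T \<nu>_star \<nu>"
proof -
  obtain T where T: "increasing_1_Lipschitz T" "\<And>u. u \<in> {0<..<1} \<Longrightarrow> T (g u + r u) = r u"
    using increasing_1_Lipschitz_interpolation[OF mono_g r'(1)] by blast
  have "AE u in unif. T (q_star u) = r u" by (rule AE_I2) (simp add: q_star_def T(2))
  then show thesis using that[of T] T(1) pushes_\<nu>_star_iff by blast
qed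

context
  fixes T assumes T: "increasing_1_Lipschitz T" "pushes_onto T \<nu>_star \<nu>"
begin

definition disp :: "real \<Rightarrow> real" where "disp x = x - T x"

lemma disp_mono: "x \<le> y \<Longrightarrow> disp x \<le> disp y" and disp_lip: "x \<le> y \<Longrightarrow> disp y - disp x \<le> y - x"
  using increasing_1_LipschitzD(2)[OF T(1), of x y] monoD[OF increasing_1_LipschitzD(1)[OF T(1)], of x y]
  by (auto simp: disp_def)

lemma disp_q_star: "AE u in unif. disp (q_star u) = g u"
proof -
  have "AE u in unif. T (q_star u) = r u" using T pushes_\<nu>_star_iff by blast
  then show ?thesis by eventually_elim (simp add: disp_def q_star_def)
qed

lemma push_unique:
  assumes "increasing_1_Lipschitz S" "pushes_onto S \<nu>_star \<nu>"
  shows "AE x in \<nu>_star. S x = T x"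
proof -
  note [measurable] = increasing_1_LipschitzD(3)[OF T(1)] increasing_1_LipschitzD(3)[OF assms(1)] q_star'(3)
  have "AE u in unif. S (q_star u) = r u" "AE u in unif. T (q_star u) = r u"
    using T assms pushes_\<nu>_star_iff by blast+
  then have "AE u in unif. S (q_star u) = T (q_star u)" by eventually_elim simp
  then show ?thesis unfolding \<nu>_star_def by (subst AE_distr_iff) auto
qed

text \<open>Along \<open>q_star\<close>, \<open>disp\<close> equals \<open>g\<close>, so
  \<open>q_star\<close> crosses \<open>z\<close> at \<open>\<alpha> k\<close> and Young's inequality
  is an equality for it. Contact gives \<open>q\<close> and \<open>q_star\<close> the same primitive
  at \<open>\<alpha> k\<close>; Young's inequality for \<open>q\<close> and the convex order then
  bound the hinge integrals against each other from both sides.\<close>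

lemma contact_hinge:
  assumes z: "\<And>w. disp w \<le> k \<longleftrightarrow> w \<le> z"
  shows "(\<integral>u. max 0 (z - q u) \<partial>unif) = (\<integral>u. max 0 (z - q_star u) \<partial>unif)"
    and "lower q (\<alpha> k) = z * \<alpha> k - (\<integral>u. max 0 (z - q u) \<partial>unif)"
proof -
  have "AE u in unif. 0 < u \<and> u < 1" by (rule AE_I2) simp
  with disp_q_star have "AE u in unif. (u \<le> \<alpha> k \<longrightarrow> q_star u \<le> z) \<and> (\<alpha> k < u \<longrightarrow> z \<le> q_star u)"
  proof eventually_elim
    fix u assume "disp (q_star u) = g u" "0 < u \<and> u < 1"
    then show "(u \<le> \<alpha> k \<longrightarrow> q_star u \<le> z) \<and> (\<alpha> k < u \<longrightarrow> z \<le> q_star u)"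
      using g_le_iff[of u k] z[of "q_star u"] by auto
  qed
  then have 1: "lower q_star (\<alpha> k) = z * \<alpha> k - (\<integral>u. max 0 (z - q_star u) \<partial>unif)"
    using lower_hinge_eq_iff[OF q_star'(2) \<alpha>] by simp
  have 2: "lower q_star (\<alpha> k) = lower q (\<alpha> k)" using contact[of k] by (simp add: lower_q_star lower_d)
  have 3: "z * \<alpha> k - (\<integral>u. max 0 (z - q u) \<partial>unif) \<le> lower q (\<alpha> k)"
    by (rule lower_hinge_le[OF q'(2) \<alpha>])
  have 4: "(\<integral>u. max 0 (z - q u) \<partial>unif) \<le> (\<integral>u. max 0 (z - q_star u) \<partial>unif)"
    using convex_le_hinge[OF \<mu>_le_\<nu>_star P1_marginals(1) \<nu>_star_P1, of z]
    unfolding \<nu>_star_def q'(3)[symmetric] using q_star'(3) by (simp add: integral_distr)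
  show "(\<integral>u. max 0 (z - q u) \<partial>unif) = (\<integral>u. max 0 (z - q_star u) \<partial>unif)"
    "lower q (\<alpha> k) = z * \<alpha> k - (\<integral>u. max 0 (z - q u) \<partial>unif)"
    using 1 2 3 4 by simp_all
qed

text \<open>If \<open>disp\<close> increased between two points of \<open>I\<close>, the last point
  \<open>z\<close> at the lower level would lie in \<open>I\<close>. But the hinge integrals, hence
  the potentials, agree at \<open>z\<close>, which excludes it from every irreducible
  interval.\<close>

lemma slope_1:
  assumes I: "I \<in> irreducible_intervals \<mu> \<nu>_star" and xy: "x \<in> I" "y \<in> I"
  shows "T y - T x = y - x"
proof -
  have eq: "disp x = disp y" if "x \<in> I" "y \<in> I" "x \<le> y" for x y
  proof (rule ccontr)
    assume "disp x \<noteq> disp y"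
    then have "disp x < disp y" using disp_mono[OF that(3)] by simp
    then obtain z where z: "x \<le> z" "z < y" "\<And>w. disp w \<le> disp x \<longleftrightarrow> w \<le> z"
      using sublevel_point[OF disp_mono disp_lip, of x "disp x" y] by (metis order_refl)
    have comp: "I \<in> components {y. potential \<mu> y < potential \<nu>_star y}"
      using I by (simp add: irreducible_intervals_def)
    have "{x..y} \<subseteq> I"
      using connected_contains_Icc[OF in_components_connected[OF comp]] that by blast
    then have "z \<in> {y. potential \<mu> y < potential \<nu>_star y}"
      using in_components_subset[OF comp] z(1,2) by (meson atLeastAtMost_iff less_imp_le subsetD)
    moreover have "potential \<mu> z = potential \<nu>_star z"
      using potential_eq_hinge[OF q'(2), of z] potential_eq_hinge[OF q_star'(2), of z] contact_hinge(1)[OF z(3)]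
      by (simp add: q' integral_q_star \<nu>_star_def)
    ultimately show False by simp
  qed
  have "disp x = disp y"
    using linear[of x y] eq[OF xy] eq[OF xy(2,1), symmetric] by blast
  then show ?thesis by (simp add: disp_def)
qed

text \<open>Equality in Young's inequality holds for \<open>q\<close> as well, so \<open>q\<close>
  crosses the same point \<open>z\<close> at \<open>\<alpha> k\<close>. Thus
  \<open>disp (q u)\<close> and \<open>g u\<close> lie on the same side of every rational
  level.\<close>

lemma disp_q: "AE u in unif. disp (q u) = g u"
proof -
  have space: "AE u in unif. 0 < u \<and> u < 1" by (rule AE_I2) simp
  have "AE u in unif. (g u \<le> k \<longrightarrow> disp (q u) \<le> k) \<and> (k < g u \<longrightarrow> k \<le> disp (q u))" for k
  proof -
    \<comment> \<open>A level outside the range of \<open>disp\<close> has no crossing point, but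
      almost every \<open>g u\<close> is a value of \<open>disp\<close> and so lies on the same side
      of it.\<close>
    consider "\<forall>x. k < disp x" | "\<forall>x. disp x \<le> k" | x y where "disp x \<le> k" "k < disp y" by (meson not_le)
    then show ?thesis
    proof cases
      case 1
      from disp_q_star show ?thesis
      proof eventually_elim
        fix u assume "disp (q_star u) = g u"
        then show "(g u \<le> k \<longrightarrow> disp (q u) \<le> k) \<and> (k < g u \<longrightarrow> k \<le> disp (q u))"
          using 1 by (metis less_imp_le not_le)
      qed
    next
      case 2
      from disp_q_star show ?thesis
      proof eventually_elim
        fix u assume "disp (q_star u) = g u"
        then show "(g u \<le> k \<longrightarrow> disp (q u) \<le> k) \<and> (k < g u \<longrightarrow> k \<le> disp (q u))"
          using 2 by (metis not_le)
      qed
    next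
      case (3 x y)
      then obtain z where z: "disp z = k" "\<And>w. disp w \<le> k \<longleftrightarrow> w \<le> z"
        using sublevel_point[OF disp_mono disp_lip, of x k y] by metis
      have "AE u in unif. (u \<le> \<alpha> k \<longrightarrow> q u \<le> z) \<and> (\<alpha> k < u \<longrightarrow> z \<le> q u)"
        using lower_hinge_eq_iff[OF q'(2) \<alpha>] contact_hinge(2)[OF z(2)] by simp
      with space show ?thesis
      proof eventually_elim
        fix u assume u: "0 < u \<and> u < 1" "(u \<le> \<alpha> k \<longrightarrow> q u \<le> z) \<and> (\<alpha> k < u \<longrightarrow> z \<le> q u)"
        then show "(g u \<le> k \<longrightarrow> disp (q u) \<le> k) \<and> (k < g u \<longrightarrow> k \<le> disp (q u))"
          using g_le_iff[of u k] z(2)[of "q u"] disp_mono[of z "q u"] z(1) by auto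
      qed
    qed
  qed
  then have "AE u in unif. \<forall>k\<in>\<rat>. (g u \<le> k \<longrightarrow> disp (q u) \<le> k) \<and> (k < g u \<longrightarrow> k \<le> disp (q u))"
    by (subst AE_ball_countable[OF countable_rat]) blast
  then show ?thesis
  proof eventually_elim
    fix u assume *: "\<forall>k\<in>\<rat>. (g u \<le> k \<longrightarrow> disp (q u) \<le> k) \<and> (k < g u \<longrightarrow> k \<le> disp (q u))"
    show "disp (q u) = g u"
    proof (rule linorder_cases)
      assume "disp (q u) < g u"
      then obtain k where "k \<in> \<rat>" "disp (q u) < k" "k < g u" using Rats_dense_in_real by blast
      then show ?thesis using * by force
    next
      assume "g u < disp (q u)"
      then obtain k where "k \<in> \<rat>" "g u < k" "k < disp (q u)" using Rats_dense_in_real by blast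
      then show ?thesis using * by force
    qed
  qed
qed

section \<open>Maximality of the pushing map among admissible maps\<close>

lemma T_meas [measurable]: "T \<in> borel_measurable borel"
  by (rule increasing_1_LipschitzD(3)[OF T(1)])

lemmas T_q = increasing_1_Lipschitz_compose[OF T(1) q'(1,2)]

lemma T_q_AE: "AE u in unif. T (q u) = q u - g u"
  using disp_q by eventually_elim (simp add: disp_def)

lemma lower_T_q: "lower (\<lambda>u. T (q u)) a = lower q a - lower g a"
proof -
  have "lower (\<lambda>u. T (q u)) a = lower (\<lambda>u. q u - g u) a"
    using T_q_AE by (intro lower_cong_AE) measurable
  then show ?thesis using q' int_g by (simp add: lower_diff)
qed

lemma integral_T_q: "(\<integral>u. T (q u) \<partial>unif) = (\<integral>u. r u \<partial>unif)"
proof -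
  have "(\<integral>u. T (q u) \<partial>unif) = (\<integral>u. q u - g u \<partial>unif)"
    using T_q_AE by (intro integral_cong_AE) measurable
  then show ?thesis using q' int_g integral_g by simp
qed

lemma distr_S: "increasing_1_Lipschitz S \<Longrightarrow> distr \<mu> borel S = distr unif borel (\<lambda>u. S (q u))"
  by (rule distr_quantile_compose[OF q increasing_1_LipschitzD(3)])

text \<open>Admissibility is the minorant inequality, read through
  \<open>T (q u) = q u - g u\<close>. For any admissible \<open>S\<close> the gap
  \<open>q u - S (q u)\<close> is increasing with primitive below that of \<open>q - r\<close>, so
  it lies below \<open>lower g\<close> and the primitives of \<open>T (q u)\<close> and
  \<open>S (q u)\<close> are ordered.\<close>

lemma T_maximal: "maximal_admissible \<mu> \<nu> T"
  unfolding maximal_admissible_def admissible_def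
proof (intro conjI allI impI; (elim conjE)?)
  have "distr unif borel (\<lambda>u. T (q u)) \<le>\<^sub>c distr unif borel r"
  proof (rule convex_le_lowerI[OF T_q(1,3) r'(2) integral_T_q])
    show "lower r a \<le> lower (\<lambda>u. T (q u)) a" if "0 < a" "a < 1" for a
      using lower_le[of a] that by (simp add: lower_T_q lower_d)
  qed
  then show "distr \<mu> borel T \<le>\<^sub>c \<nu>" by (simp add: distr_S T r')
next
  fix S assume S: "increasing_1_Lipschitz S" and le: "distr \<mu> borel S \<le>\<^sub>c \<nu>"
  note S_q = increasing_1_Lipschitz_compose[OF S q'(1,2)]
  have le': "distr unif borel (\<lambda>u. S (q u)) \<le>\<^sub>c distr unif borel r"
    using le by (simp add: distr_S S r')
  note Sr = convex_le_lowerD[OF le' S_q(3) r'(2)]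
  define h where "h u = q u - S (q u)" for u
  have h: "mono_on {0<..<1} h" "integrable unif h" using S_q q' by (simp_all add: h_def[abs_def])
  have lower_h: "lower h a = lower q a - lower (\<lambda>u. S (q u)) a" for a
    unfolding h_def using q' S_q by (simp add: lower_diff)
  have hg: "lower h a \<le> lower g a" if a: "0 \<le> a" "a \<le> 1" for a
  proof (rule lower_maximal[OF h _ _ a])
    show "(\<integral>u. h u \<partial>unif) = (\<integral>u. q u - r u \<partial>unif)"
      using q' S_q r' Sr(1) by (simp add: h_def)
    show "lower h a \<le> lower (\<lambda>u. q u - r u) a" if "0 \<le> a" "a \<le> 1" for a
      using Sr(2)[OF r'(1) that] by (simp add: lower_h lower_d)
  qed
  have "distr unif borel (\<lambda>u. S (q u)) \<le>\<^sub>c distr unif borel (\<lambda>u. T (q u))"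
  proof (rule convex_le_lowerI[OF S_q(1,3) T_q(3)])
    show "(\<integral>u. S (q u) \<partial>unif) = (\<integral>u. T (q u) \<partial>unif)" by (simp add: Sr(1) integral_T_q)
    show "lower (\<lambda>u. T (q u)) a \<le> lower (\<lambda>u. S (q u)) a" if "0 < a" "a < 1" for a
      using hg[of a] that by (simp add: lower_h lower_T_q)
  qed
  then show "distr \<mu> borel S \<le>\<^sub>c distr \<mu> borel T" by (simp add: distr_S T S)
qed (rule T)

text \<open>Two maximal maps dominate each other, so their push-forwards coincide by antisymmetry.
  Both are increasing along \<open>q\<close>, hence almost everywhere equal there.\<close>

lemma T_weak_monotone_rearrangement: "is_weak_monotone_rearrangement \<mu> \<nu> T"
  unfolding is_weak_monotone_rearrangement_def
proof (intro conjI allI impI)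
  show "maximal_admissible \<mu> \<nu> T" by (rule T_maximal)
  fix S assume S: "maximal_admissible \<mu> \<nu> S"
  then have S': "increasing_1_Lipschitz S" by (simp add: maximal_admissible_def admissible_def)
  note [measurable] = increasing_1_LipschitzD(3)[OF S']
  note S_q = increasing_1_Lipschitz_compose[OF S' q'(1,2)]
  have "distr \<mu> borel S = distr \<mu> borel T"
  proof (rule convex_le_antisym)
    show "distr \<mu> borel S \<in> P1" "distr \<mu> borel T \<in> P1"
      using distr_unif_P1[OF S_q(3)] distr_unif_P1[OF T_q(3)] by (simp_all add: distr_S T S')
  qed (use S T_maximal in \<open>auto simp: maximal_admissible_def\<close>)
  then have "distr unif borel (\<lambda>u. S (q u)) = distr unif borel (\<lambda>u. T (q u))"
    by (simp add: distr_S T S')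
  then have "AE u in unif. S (q u) = T (q u)" by (rule mono_on_distr_unique[OF S_q(1) T_q(1)])
  then have "AE x in distr unif borel q. S x = T x" by (subst AE_distr_iff) auto
  then show "AE x in \<mu>. S x = T x" unfolding q'(3) .
qed

end

end

section \<open>Existence, uniqueness and properties of the smallest dominating measure\<close>

theorem theorem1p4:
  fixes \<mu> \<nu> :: "real measure"
  assumes "\<mu> \<in> P1" and "\<nu> \<in> P1"
  defines "A \<equiv> {\<eta> \<in> dominating \<mu>. \<exists>S. increasing_1_Lipschitz S \<and> pushes_onto S \<eta> \<nu>}"
  shows "\<exists>\<nu>'. is_smallest A \<nu>' \<and> (\<forall>\<eta>. is_smallest A \<eta> \<longrightarrow> \<eta> = \<nu>') \<and>
     (\<forall>\<theta>. convex_on UNIV \<theta> \<longrightarrow> is_optimizer \<theta> \<mu> \<nu> \<nu>') \<and>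
     (\<forall>\<theta>. strictly_convex \<theta> \<and> \<bar>V \<theta> \<mu> \<nu>\<bar> \<noteq> \<infinity> \<longrightarrow>
        is_optimizer \<theta> \<mu> \<nu> \<nu>' \<and> (\<forall>\<eta>. is_optimizer \<theta> \<mu> \<nu> \<eta> \<longrightarrow> \<eta> = \<nu>')) \<and>
     (\<exists>T. increasing_1_Lipschitz T \<and> pushes_onto T \<nu>' \<nu> \<and>
        (\<forall>S. increasing_1_Lipschitz S \<and> pushes_onto S \<nu>' \<nu> \<longrightarrow> (AE x in \<nu>'. S x = T x)) \<and>
        (\<forall>I\<in>irreducible_intervals \<mu> \<nu>'. \<forall>x\<in>I. \<forall>y\<in>I. T y - T x = y - x) \<and>
        is_weak_monotone_rearrangement \<mu> \<nu> T)"
proof -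
  obtain q r where q: "quantile_of \<mu> q" and r: "quantile_of \<nu> r"
    using quantile_of_exists assms(1,2) by metis
  have "integrable unif (\<lambda>u. q u - r u)" using q r by (auto simp: quantile_of_def)
  then obtain g \<alpha> where "convex_minorant (\<lambda>u. q u - r u) g \<alpha>"
    using convex_minorant_exists by blast
  then interpret quantile_minorant q r g \<alpha> \<mu> \<nu>
    using q r by (simp add: quantile_minorant_def quantile_minorant_axioms_def)
  obtain T where T: "increasing_1_Lipschitz T" "pushes_onto T \<nu>_star \<nu>" by (rule push_exists)
  have smallest: "is_smallest A \<nu>_star"
    using \<nu>_star_dominating T \<nu>_star_least unfolding is_smallest_def A_def by blast
  have unique: "\<eta> = \<nu>_star" if "is_smallest A \<eta>" for \<eta>
    using that smallest by (intro convex_le_antisym) (auto simp: is_smallest_def A_def dominating_def)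
  show ?thesis
  proof (intro exI[of _ \<nu>_star] conjI allI ballI impI exI[of _ T])
    show "is_optimizer \<theta> \<mu> \<nu> \<nu>_star" if "strictly_convex \<theta> \<and> \<bar>V \<theta> \<mu> \<nu>\<bar> \<noteq> \<infinity>" for \<theta>
      using that strictly_convex_imp_convex \<nu>_star_optimizer by blast
    show "\<eta> = \<nu>_star" if "strictly_convex \<theta> \<and> \<bar>V \<theta> \<mu> \<nu>\<bar> \<noteq> \<infinity>" "is_optimizer \<theta> \<mu> \<nu> \<eta>" for \<theta> \<eta>
      using optimizer_unique[OF conjunct1[OF that(1)] conjunct2[OF that(1)] that(2)] .
    show "AE x in \<nu>_star. S x = T x" if "increasing_1_Lipschitz S \<and> pushes_onto S \<nu>_star \<nu>" for S
      using push_unique[OF T conjunct1[OF that] conjunct2[OF that]] .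
    show "T y - T x = y - x" if "I \<in> irreducible_intervals \<mu> \<nu>_star" "x \<in> I" "y \<in> I" for I x y
      using slope_1[OF T that] .
    show "\<eta> = \<nu>_star" if "is_smallest A \<eta>" for \<eta> by (rule unique[OF that])
    show "is_optimizer \<theta> \<mu> \<nu> \<nu>_star" if "convex_on UNIV \<theta>" for \<theta> by (rule \<nu>_star_optimizer[OF that])
    show "is_weak_monotone_rearrangement \<mu> \<nu> T" by (rule T_weak_monotone_rearrangement[OF T])
  qed (rule smallest T)+
qed

end
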